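(* Let $k\ge 0$ and $\ell\ge 1$ be integers. Let $T$ be an antidirected tree with $k$ edges, and let $D$ be a digraph with $\bar{\delta}^0(D)\ge \max\{k/\ell,\Delta(T)\}$. If $D$ is $\mathcal{C}_{\le 2\ell}^*$-free, then $D$ contains $T$ as a subgraph.
   Context: Digraphs have a nonempty vertex set and no loops or parallel arcs, but a pair of opposite arcs $(x,y),(y,x)$ is allowed. An oriented tree is an orientation of an undirected tree; it is antidirected if it contains no directed path of length $2$ (i.e. no vertex has both positive in-degree and positive out-degree). $\Delta(T)$ is the maximum degree of the underlying undirected graph of $T$. The minimum pseudo-semidegree $\bar{\delta}^0(D)$ is $0$ if $D$ has no arcs, and otherwise is the smaller of the minimum positive out-degree and the minimum positive in-degree of $D$ (minima taken over vertices whose out-degree, respectively in-degree, is positive). An oriented cycle is any orientation of an undirected cycle; a directed cycle is one in which all arcs are consistently oriented. $\mathcal{C}_{\le 2\ell}$ is the set of all oriented cycles $C$ with $3\le |C|\le 2\ell$, and $\mathcal{C}_{\le 2\ell}^*$ is $\mathcal{C}_{\le 2\ell}$ with all directed cycles removed. A digraph is $\mathcal{F}$-free if it contains no member of $\mathcal{F}$ as a (not necessarily induced) subgraph. $D$ contains $T$ if there is an injective map $f\colon V(T)\to V(D)$ such that $(f(u),f(v))$ is an arc of $D$ for every arc $(u,v)$ of $T$. *)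

theory Defs
  imports Complex_Main "Graph_Theory.Graph_Theory"
begin

(* Digraphs are pair_pre_digraph records; the locale pair_digraph says finite, without loops
   (parallel arcs cannot occur), opposite arcs allowed. It admits the empty vertex set, so
   nonemptiness is a separate condition. A simple undirected graph is a symmetric digraph
   (locale pair_graph), each undirected edge being a pair of opposite arcs, and
   mk_symmetric G is the underlying undirected graph of G. *)

definition orientation_of :: "'a pair_pre_digraph \<Rightarrow> 'a pair_pre_digraph \<Rightarrow> bool" where
  "orientation_of G U \<longleftrightarrow> pair_graph U \<and> asym (parcs G) \<and> mk_symmetric G = U"

(* The constants tree and forest of Graph_Theory exclude directed cycles only, hence are not
   used here. An undirected edge is a closed walk of length 2 in a symmetric digraph, so an
   undirected cycle has length at least 3. *)
definition undirected_tree :: "'a pair_pre_digraph \<Rightarrow> bool" where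
  "undirected_tree U \<longleftrightarrow>
     pair_graph U \<and> connected U \<and> \<not> (\<exists>p. pre_digraph.cycle U p \<and> 3 \<le> length p)"

definition oriented_tree :: "'a pair_pre_digraph \<Rightarrow> bool" where
  "oriented_tree T \<longleftrightarrow> (\<exists>U. undirected_tree U \<and> orientation_of T U)"

definition antidirected :: "'a pair_pre_digraph \<Rightarrow> bool" where
  "antidirected G \<longleftrightarrow>
     \<not> (\<exists>u v w. distinct [u, v, w] \<and> (u, v) \<in> parcs G \<and> (v, w) \<in> parcs G)"

definition antidirected_tree :: "'a pair_pre_digraph \<Rightarrow> bool" where
  "antidirected_tree T \<longleftrightarrow> oriented_tree T \<and> antidirected T"

(* In a symmetric digraph the out-degree of a vertex is its number of neighbours. *)
definition max_degree :: "'a pair_pre_digraph \<Rightarrow> nat" where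
  "max_degree G = Max (out_degree (mk_symmetric G) ` pverts G)"

definition min_pseudo_semidegree :: "'a pair_pre_digraph \<Rightarrow> nat" where
  "min_pseudo_semidegree G =
     (if parcs G = {} then 0
      else min (Min {out_degree G v | v. v \<in> pverts G \<and> 0 < out_degree G v})
               (Min {in_degree G v | v. v \<in> pverts G \<and> 0 < in_degree G v}))"

(* zip vs (rotate1 vs) lists the arcs from each entry of vs to its cyclic successor. *)
definition directed_cycle :: "'a pair_pre_digraph \<Rightarrow> bool" where
  "directed_cycle C \<longleftrightarrow>
     (\<exists>vs. distinct vs \<and> 3 \<le> length vs \<and>
           C = \<lparr>pverts = set vs, parcs = set (zip vs (rotate1 vs))\<rparr>)"

definition undirected_cycle :: "'a pair_pre_digraph \<Rightarrow> bool" where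
  "undirected_cycle U \<longleftrightarrow> (\<exists>C. directed_cycle C \<and> U = mk_symmetric C)"

definition oriented_cycle :: "'a pair_pre_digraph \<Rightarrow> bool" where
  "oriented_cycle C \<longleftrightarrow> (\<exists>U. undirected_cycle U \<and> orientation_of C U)"

(* Vertex type nat: every finite digraph has an isomorphic copy there, and containment
   below is up to isomorphism. *)
definition oriented_cycles_upto :: "nat \<Rightarrow> nat pair_pre_digraph set" where
  "oriented_cycles_upto m =
     {C. oriented_cycle C \<and> 3 \<le> card (pverts C) \<and> card (pverts C) \<le> m}"

definition nondirected_cycles_upto :: "nat \<Rightarrow> nat pair_pre_digraph set" where
  "nondirected_cycles_upto m = oriented_cycles_upto m - {C. directed_cycle C}"

definition contains_digraph :: "'a pair_pre_digraph \<Rightarrow> 'b pair_pre_digraph \<Rightarrow> bool" where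
  "contains_digraph D H \<longleftrightarrow>
     (\<exists>f. f ` pverts H \<subseteq> pverts D \<and> inj_on f (pverts H) \<and>
          (\<forall>(u, v) \<in> parcs H. (f u, f v) \<in> parcs D))"

definition free_of :: "'a pair_pre_digraph \<Rightarrow> 'b pair_pre_digraph set \<Rightarrow> bool" where
  "free_of D \<F> \<longleftrightarrow> \<not> (\<exists>F \<in> \<F>. contains_digraph D F)"

end

theory Submission
  imports Defs "HOL-Library.FuncSet"
begin

text \<open>
  Let \<open>d\<close> be the minimum pseudo-semidegree of \<open>D\<close>. Every vertex of an antidirected tree \<open>T\<close> is a
  source or a sink, so a copy of \<open>T\<close> maps the neighbours of a source to out-neighbours of its image
  and the neighbours of a sink to in-neighbours of its image. As soon as one arc at a vertex of \<open>D\<close>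
  is used in a given direction, there are at least \<open>d\<close> arcs to choose from. Walks in \<open>T\<close> become
  walks in \<open>D\<close> whose arcs alternate in direction; a closed walk of this kind that never backtracks
  contains a cycle with two consecutive arcs of opposite direction. Hence in \<open>D\<close> it has length
  greater than \<open>2 l\<close> (\<open>alternating_walk_not_closed\<close>).

  If \<open>k \<le> d\<close>, and in particular if \<open>l = 1\<close>, the tree is embedded greedily (\<open>greedy_copy\<close>).

  For \<open>l \<ge> 3\<close> a random map works. Root \<open>T\<close>; going down the tree, send the children of a vertex to
  distinct neighbours of its image, other than the image of its parent. The result is always locally
  injective, so two vertices of \<open>T\<close> at distance at most \<open>2 l\<close> never collide. Of two vertices at
  larger distance one, say \<open>j\<close>, has its last \<open>l\<close> proper ancestors below the branching point of the
  connecting path. The choices made at these ancestors lead to \<open>(d - 1)\<^sup>l\<close> different images of \<open>j\<close>,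
  because two walks that diverge and meet again within \<open>l\<close> steps would close up; at most one of the
  images is that of the other vertex. So each far pair collides with probability at most
  \<open>(d - 1)\<close> to the power \<open>- l\<close> (\<open>card_collisions\<close>). A tree with \<open>k\<close> edges has at most
  \<open>(k - 2 l) (k - 2 l + 1) / 2\<close> far pairs (\<open>card_far_pairs\<close>), and for \<open>l \<ge> 3\<close>, \<open>d \<ge> 2\<close> and \<open>k \<le> l d\<close>
  this is less than \<open>(d - 1)\<^sup>l\<close> (\<open>far_pairs_bound_less_power\<close>). By the union bound some choice is injective.
  The random choice is a single shift per vertex that rotates a fixed list of \<open>d - 1\<close> candidates,
  which makes all choices equally likely and turns probabilities into cardinalities.

  For \<open>l = 2\<close> the union bound is too weak by a factor of about two, but an induction on \<open>k\<close>
  succeeds. Let \<open>p\<close> be a vertex all of whose neighbours except its parent \<open>q\<close> are leaves, \<open>c\<close> of them.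
  Embed the tree without these leaves. If the image of \<open>p\<close> has fewer than \<open>c\<close> unused neighbours, move
  \<open>p\<close> to another neighbour \<open>u\<close> of the image of \<open>q\<close>; if \<open>u\<close> is occupied by a leaf attached to \<open>q\<close>,
  that leaf and \<open>p\<close> change places. In the absence of nondirected triangles and four-cycles
  the second neighbourhoods of distinct \<open>u\<close> are disjoint, and if no \<open>u\<close> were suitable, the copy would have too
  many vertices (\<open>room_for_star\<close>).

  Both arguments run on trees whose vertices are numbered in breadth-first order: parents have smaller
  numbers, and the children of the last parent are the last vertices.
\<close>

section \<open>Closed walks and cycles\<close>

text \<open>A closed segment of minimal length has no repeated vertex; as the walk neither stays nor
  backtracks, the segment has length at least three.\<close>

lemma closed_walk_contains_cycle:
  fixes w :: "nat \<Rightarrow> 'a"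
  assumes "0 < s" "w 0 = w s"
    and step: "\<And>r. r < s \<Longrightarrow> w r \<noteq> w (Suc r)"
    and nonback: "\<And>r. r + 2 \<le> s \<Longrightarrow> w r \<noteq> w (r + 2)"
  obtains i m where "3 \<le> m" "i + m \<le> s" "w (i + m) = w i" "inj_on w {i..<i + m}"
proof -
  let ?P = "\<lambda>m. 0 < m \<and> (\<exists>i. i + m \<le> s \<and> w (i + m) = w i)"
  define m where "m = (LEAST m. ?P m)"
  have "?P s" using assms by (auto intro: exI[of _ 0])
  then have Pm: "?P m" unfolding m_def by (rule LeastI)
  have least: "m \<le> m'" if "?P m'" for m' unfolding m_def using that by (rule Least_le)
  from Pm obtain i where i: "i + m \<le> s" "w (i + m) = w i" and m0: "0 < m" by blast
  have "m \<noteq> 1" using step[of i] i by auto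
  moreover have "m \<noteq> 2" using nonback[of i] i by auto
  ultimately have "3 \<le> m" using m0 by linarith
  have neq: "w a \<noteq> w b" if "i \<le> a" "a < b" "b < i + m" for a b
  proof
    assume "w a = w b"
    then have "?P (b - a)" using that i by (auto intro!: exI[of _ a])
    from least[OF this] that show False by linarith
  qed
  have "inj_on w {i..<i + m}"
  proof (rule inj_onI)
    fix a b assume "a \<in> {i..<i + m}" "b \<in> {i..<i + m}" "w a = w b"
    then show "a = b" using neq[of a b] neq[of b a] by (cases a b rule: linorder_cases) auto
  qed
  with \<open>3 \<le> m\<close> i that show thesis by blast
qed

text \<open>Translation of cycles given by vertex functions into the arc lists that \<open>pre_digraph.cycle\<close> is
  about.\<close>

lemma cycle_of_closed_walk:
  assumes wf: "pair_wf_digraph U"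
    and arcs: "\<And>r. r < m \<Longrightarrow> (w r, w (Suc r)) \<in> parcs U"
    and inj: "inj_on w {..<m}" and closed: "w m = w 0" and "0 < m"
  shows "pre_digraph.cycle (with_proj U) (map (\<lambda>r. (w r, w (Suc r))) [0..<m])"
proof -
  interpret pair_wf_digraph U by (rule wf)
  let ?p = "\<lambda>k. map (\<lambda>r. (w r, w (Suc r))) [m - k..<m]"
  have walk: "pcas (w (m - k)) (?p k) (w m) \<and> pawalk_verts (w (m - k)) (?p k) = map w [m - k..<Suc m]"
    if "k \<le> m" for k
    using that
  proof (induction k)
    case (Suc k)
    have "[m - Suc k..<m] = (m - Suc k) # [m - k..<m]"
      using Suc.prems by (subst upt_conv_Cons) (auto simp: Suc_diff_Suc)
    moreover have "[m - Suc k..<Suc m] = (m - Suc k) # [m - k..<Suc m]"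
      using Suc.prems by (subst upt_conv_Cons) (auto simp: Suc_diff_Suc)
    ultimately show ?case using Suc by (simp add: Suc_diff_Suc)
  qed simp
  have "distinct (map w [Suc 0..<Suc m])"
  proof -
    have neq: "w i \<noteq> w j" if "0 < i" "i < j" "j \<le> m" for i j
    proof (cases "j = m")
      case True
      then show ?thesis using inj_onD[OF inj, of i 0] closed that by auto
    next
      case False
      then show ?thesis using inj_onD[OF inj, of i j] that by auto
    qed
    have "inj_on w {Suc 0..<Suc m}"
    proof (rule inj_onI)
      fix i j assume "i \<in> {Suc 0..<Suc m}" "j \<in> {Suc 0..<Suc m}" "w i = w j"
      then show "i = j" using neq[of i j] neq[of j i] by (cases i j rule: linorder_cases) auto
    qed
    then show ?thesis by (simp add: distinct_map del: upt_Suc)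
  qed
  moreover have "tl (map w [0..<Suc m]) = map w [Suc 0..<Suc m]"
    by (simp add: upt_conv_Cons del: upt_Suc)
  moreover have "w 0 \<in> pverts U" using arcs[of 0] \<open>0 < m\<close> by (auto dest: wellformed')
  ultimately show ?thesis
    unfolding cycle_def awalk_def using walk[of m] closed arcs \<open>0 < m\<close>
    by (intro exI[of _ "w 0"]) auto
qed

section \<open>Digraphs without short nondirected cycles\<close>

text \<open>The direction flag treats out-neighbours and in-neighbours alike; it is also used for the side
  of a tree vertex in the bipartition into sources and sinks.\<close>

definition oarc :: "'b rel \<Rightarrow> bool \<Rightarrow> 'b \<Rightarrow> 'b \<Rightarrow> bool" where
  "oarc A out v w \<longleftrightarrow> (if out then (v, w) \<in> A else (w, v) \<in> A)"

lemma oarc_flip: "oarc A out v w \<longleftrightarrow> oarc A (\<not> out) w v"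
  by (auto simp: oarc_def)

text \<open>Everything that is needed about \<open>D\<close>. The assumption on short cycles speaks of cyclic sequences
  of vertices in which each step follows an arc forwards or backwards as told by \<open>out\<close>. A cycle is
  nondirected iff some two consecutive steps differ in direction, and by rotation these are the
  first two.\<close>

locale host =
  fixes A :: "'b rel" and d l :: nat
  assumes finite_A: "finite A"
    and loopfree: "(v, v) \<notin> A"
    and no_short_cycle: "\<And>n w out. \<lbrakk>3 \<le> n; n \<le> 2 * l; inj_on w {..<n};
      \<And>r. r < n \<Longrightarrow> oarc A (out r) (w r) (w (Suc r mod n)); out 0 \<noteq> out (1::nat)\<rbrakk> \<Longrightarrow> False"
    and semidegree: "\<And>out v w. oarc A out v w \<Longrightarrow> d \<le> card {w. oarc A out v w}"
begin

definition nbs :: "bool \<Rightarrow> 'b \<Rightarrow> 'b set" where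
  "nbs out v = {w. oarc A out v w}"

lemma finite_nbs [simp]: "finite (nbs out v)"
proof -
  have "nbs out v \<subseteq> fst ` A \<union> snd ` A"
    by (force simp: nbs_def oarc_def split: if_splits)
  then show ?thesis using finite_A by (meson finite_Un finite_imageI finite_subset)
qed

lemma nbs_flip: "w \<in> nbs out v \<longleftrightarrow> v \<in> nbs (\<not> out) w"
  using oarc_flip[of A out v w] by (simp add: nbs_def)

lemma card_nbs: "w \<in> nbs out v \<Longrightarrow> d \<le> card (nbs out v)"
  using semidegree by (auto simp: nbs_def)

lemma not_self_nbs [simp]: "v \<notin> nbs out v"
  using loopfree by (auto simp: nbs_def oarc_def)

text \<open>Directions alternate along the walk, so the cycle inside a closed walk has two consecutive steps
  of different direction and is nondirected, even if it closes up with two equal directions because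
  its length is odd.\<close>

lemma alternating_walk_not_closed:
  assumes arcs: "\<And>r. r < s \<Longrightarrow> w (Suc r) \<in> nbs (out r) (w r)"
    and alt: "\<And>r. Suc r < s \<Longrightarrow> out (Suc r) \<longleftrightarrow> \<not> out r"
    and nonback: "\<And>r. r + 2 \<le> s \<Longrightarrow> w r \<noteq> w (r + 2)"
    and "0 < s" "s \<le> 2 * l"
  shows "w 0 \<noteq> w s"
proof
  assume "w 0 = w s"
  have step: "w r \<noteq> w (Suc r)" if "r < s" for r
    using arcs[OF that] not_self_nbs by metis
  obtain i m where m: "3 \<le> m" "i + m \<le> s" and closed: "w (i + m) = w i"
    and inj: "inj_on w {i..<i + m}"
    using closed_walk_contains_cycle[of s w] \<open>0 < s\<close> \<open>w 0 = w s\<close> step nonback by metis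
  have inj': "inj_on (\<lambda>r. w (i + r)) {..<m}"
  proof (rule inj_onI)
    fix a b assume "a \<in> {..<m}" "b \<in> {..<m}" "w (i + a) = w (i + b)"
    then show "a = b" using inj_onD[OF inj, of "i + a" "i + b"] by auto
  qed
  have "oarc A (out (i + r)) (w (i + r)) (w (i + Suc r mod m))" if "r < m" for r
  proof -
    have "w (i + Suc r mod m) = w (Suc (i + r))"
      using that closed by (cases "Suc r = m") auto
    then show ?thesis using arcs[of "i + r"] that m by (simp add: nbs_def)
  qed
  moreover have "out (i + 0) \<noteq> out (i + 1)" using alt[of i] m by auto
  ultimately show False
    using no_short_cycle[of m "\<lambda>r. w (i + r)" "\<lambda>r. out (i + r)"] m inj' \<open>s \<le> 2 * l\<close> by simp
qed

text \<open>Running back along one walk and then forth along the other never backtracks if the walks diverge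
  in the first step. This form covers both the images of the two branches of a tree path and the
  images of one branch under two different maps.\<close>

lemma diverging_walks_do_not_meet:
  assumes x: "\<And>r. r < a \<Longrightarrow> x (Suc r) \<in> nbs (even r = out) (x r)"
    and y: "\<And>r. r < b \<Longrightarrow> y (Suc r) \<in> nbs (even r = out) (y r)"
    and xn: "\<And>r. r + 2 \<le> a \<Longrightarrow> x r \<noteq> x (r + 2)"
    and yn: "\<And>r. r + 2 \<le> b \<Longrightarrow> y r \<noteq> y (r + 2)"
    and start: "x 0 = y 0" and diverge: "0 < a \<Longrightarrow> 0 < b \<Longrightarrow> x 1 \<noteq> y 1"
    and len: "0 < a + b" "a + b \<le> 2 * l"
  shows "x a \<noteq> y b"
proof -
  define w where "w r = (if r \<le> a then x (a - r) else y (r - a))" for r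
  \<comment> \<open>The walk runs backwards along \<open>x\<close>, then forwards along \<open>y\<close>; on the backward part each
    arc is traversed against the direction in which \<open>x\<close> uses it.\<close>
  define o' where "o' r = (if r < a then \<not> (even (a - Suc r) = out) else (even (r - a) = out))" for r
  have "w 0 \<noteq> w (a + b)"
  proof (rule alternating_walk_not_closed[of "a + b" w o'])
    show "w (Suc r) \<in> nbs (o' r) (w r)" if "r < a + b" for r
    proof (cases "r < a")
      case True
      then have "Suc (a - Suc r) = a - r" by simp
      with x[of "a - Suc r"] True have "x (a - r) \<in> nbs (even (a - Suc r) = out) (x (a - Suc r))"
        by simp
      then show ?thesis using True nbs_flip[of "x (a - r)"] by (simp add: w_def o'_def)
    next
      case False
      then have "w r = y (r - a)" using start by (auto simp: w_def)
      moreover have "w (Suc r) = y (Suc (r - a))" using False by (simp add: w_def Suc_diff_le)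
      ultimately show ?thesis using y[of "r - a"] False that by (simp add: o'_def)
    qed
    show "o' (Suc r) \<longleftrightarrow> \<not> o' r" if "Suc r < a + b" for r
    proof -
      consider "Suc r < a" | "Suc r = a" | "a \<le> r" by linarith
      then show ?thesis
      proof cases
        case 1
        then have "a - Suc r = Suc (a - Suc (Suc r))" by simp
        then show ?thesis using 1 by (auto simp: o'_def)
      next
        case 2 then show ?thesis by (auto simp: o'_def)
      next
        case 3 then show ?thesis by (auto simp: o'_def Suc_diff_le)
      qed
    qed
    show "w r \<noteq> w (r + 2)" if "r + 2 \<le> a + b" for r
    proof -
      consider "r + 2 \<le> a" | "Suc r = a" | "a \<le> r" by linarith
      then show ?thesis
      proof cases
        case 1
        then have "a - (r + 2) + 2 = a - r" by simp
        then show ?thesis using 1 xn[of "a - (r + 2)"] by (auto simp: w_def)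
      next
        case 2
        then have "w r = x 1" "w (r + 2) = y 1" by (auto simp: w_def)
        then show ?thesis using diverge 2 that by auto
      next
        case 3
        then have "w r = y (r - a)" "w (r + 2) = y (r - a + 2)"
          using 3 start by (auto simp: w_def Suc_diff_le)
        then show ?thesis using 3 yn[of "r - a"] that by simp
      qed
    qed
  qed (use len in auto)
  moreover have "w 0 = x a" by (simp add: w_def)
  moreover have "w (a + b) = y b" using start by (auto simp: w_def)
  ultimately show ?thesis by simp
qed

end

context host
begin

text \<open>A cycle through two outgoing (or two ingoing) arcs of a vertex is nondirected, so triangles and
  four-cycles of this kind are excluded for any direction of the other arcs.\<close>

lemma no_triangle:
  assumes "2 \<le> l" "a \<in> nbs out v" "b \<in> nbs out v" "b \<in> nbs out' a"
  shows False
proof -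
  have "a \<noteq> v" "b \<noteq> v" "a \<noteq> b" using assms not_self_nbs by metis+
  have flipped: "v \<in> nbs (\<not> out) a" "a \<in> nbs (\<not> out') b"
    using assms(2,4) nbs_flip by blast+
  let ?w = "\<lambda>r. [a, v, b] ! r" and ?o = "\<lambda>r. [\<not> out, out, \<not> out'] ! r"
  have "inj_on ?w {..<3}"
    using \<open>a \<noteq> v\<close> \<open>b \<noteq> v\<close> \<open>a \<noteq> b\<close> by (intro inj_on_nth) auto
  moreover have "oarc A (?o r) (?w r) (?w (Suc r mod 3))" if "r < 3" for r
  proof -
    have "r = 0 \<or> r = 1 \<or> r = 2" using that by linarith
    then consider "r = 0" | "r = 1" | "r = 2" by blast
    then show ?thesis using assms(3) flipped by cases (simp_all add: nbs_def)
  qed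
  ultimately show False using no_short_cycle[of 3 ?w ?o] \<open>2 \<le> l\<close> by simp
qed

lemma no_square:
  assumes "2 \<le> l" "a \<in> nbs out v" "b \<in> nbs out v" "a \<noteq> b"
    and "y \<in> nbs out1 a" "y \<in> nbs out2 b" "y \<noteq> v"
  shows False
proof -
  have "a \<noteq> v" "b \<noteq> v" "y \<noteq> a" "y \<noteq> b" using assms not_self_nbs by metis+
  have flipped: "v \<in> nbs (\<not> out) a" "a \<in> nbs (\<not> out1) y"
    using assms(2,5) nbs_flip by blast+
  let ?w = "\<lambda>r. [a, v, b, y] ! r" and ?o = "\<lambda>r. [\<not> out, out, out2, \<not> out1] ! r"
  have "inj_on ?w {..<4}"
    using \<open>a \<noteq> v\<close> \<open>b \<noteq> v\<close> \<open>y \<noteq> a\<close> \<open>y \<noteq> b\<close> assms(4,7) by (intro inj_on_nth) auto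
  moreover have "oarc A (?o r) (?w r) (?w (Suc r mod 4))" if "r < 4" for r
  proof -
    have "r = 0 \<or> r = 1 \<or> r = 2 \<or> r = 3" using that by linarith
    then consider "r = 0" | "r = 1" | "r = 2" | "r = 3" by blast
    then show ?thesis using assms(3,6) flipped by cases (simp_all add: nbs_def)
  qed
  ultimately show False using no_short_cycle[of 4 ?w ?o] \<open>2 \<le> l\<close> by simp
qed

end

section \<open>Numbered rooted trees\<close>

text \<open>The vertices are all natural numbers and \<open>0\<close> is the root; a tree with \<open>n\<close> edges uses the vertices
  up to \<open>n\<close>. As the root is its own parent, \<open>(par ^^ r) i\<close> is defined for all \<open>r\<close>, and the ancestors
  of \<open>i\<close> decrease strictly until they reach \<open>0\<close>.\<close>

locale numbering =
  fixes par :: "nat \<Rightarrow> nat" and source :: "nat \<Rightarrow> bool"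
  assumes par_0 [simp]: "par 0 = 0"
    and par_less: "0 < i \<Longrightarrow> par i < i"
    and source_par: "0 < i \<Longrightarrow> source i \<longleftrightarrow> \<not> source (par i)"
begin

lemma par_le: "par i \<le> i"
  using par_less[of i] by (cases "i = 0") auto

lemma par_funpow_0 [simp]: "(par ^^ r) 0 = 0"
  by (induction r) auto

lemma par_funpow_le: "(par ^^ r) i \<le> i"
proof (induction r)
  case (Suc r)
  then show ?case using par_le[of "(par ^^ r) i"] by simp
qed simp

lemma par_funpow_antimono: "r \<le> s \<Longrightarrow> (par ^^ s) i \<le> (par ^^ r) i"
proof (induction rule: dec_induct)
  case (step s)
  then show ?case using par_le[of "(par ^^ s) i"] by simp
qed simp

lemma par_funpow_strict:
  assumes "r < s" "(par ^^ r) i \<noteq> 0"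
  shows "(par ^^ s) i < (par ^^ r) i"
proof -
  have "(par ^^ s) i \<le> (par ^^ Suc r) i" using assms(1) by (intro par_funpow_antimono) simp
  also have "\<dots> < (par ^^ r) i" using par_less[of "(par ^^ r) i"] assms(2) by simp
  finally show ?thesis .
qed

lemma par_funpow_reaches_0: 
  assumes "i \<le> r" shows "(par ^^ r) i = 0"
proof -
  have "(par ^^ r) i \<le> i - r" for r
  proof (induction r)
    case (Suc r)
    then show ?case using par_less[of "(par ^^ r) i"] by (cases "(par ^^ r) i = 0") simp_all
  qed simp
  from this[of r] assms show ?thesis by simp
qed

text \<open>Distance at most \<open>s\<close> in the tree: the path climbs from \<open>i\<close> in \<open>a\<close> steps to a common ancestor and
  descends to \<open>j\<close> in \<open>b\<close> steps.\<close>

definition near :: "nat \<Rightarrow> nat \<Rightarrow> nat \<Rightarrow> bool" where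
  "near s i j \<longleftrightarrow> (\<exists>a b. a + b \<le> s \<and> (par ^^ a) i = (par ^^ b) j)"

text \<open>Minimality of \<open>a + b\<close> makes the connecting walk a path: neither branch passes through the root
  before its end, and the branches leave the common ancestor through different children.\<close>

lemma near_obtains_path:
  assumes "near s i j" "i \<noteq> j"
  obtains a b where "0 < a + b" "a + b \<le> s" "(par ^^ a) i = (par ^^ b) j"
    "\<forall>r<a. (par ^^ r) i \<noteq> 0" "\<forall>r<b. (par ^^ r) j \<noteq> 0"
    "0 < a \<and> 0 < b \<longrightarrow> (par ^^ (a - 1)) i \<noteq> (par ^^ (b - 1)) j"
proof -
  let ?P = "\<lambda>s. \<exists>a b. a + b = s \<and> (par ^^ a) i = (par ^^ b) j"
  define m where "m = (LEAST s. ?P s)"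
  obtain a0 b0 where ab0: "a0 + b0 \<le> s" "(par ^^ a0) i = (par ^^ b0) j"
    using assms(1) unfolding near_def by blast
  then have "?P (a0 + b0)" by blast
  then have "?P m" and "m \<le> a0 + b0" unfolding m_def by (rule LeastI, rule Least_le)
  then obtain a b where ab: "a + b = m" "(par ^^ a) i = (par ^^ b) j" by blast
  have least: "m \<le> a' + b'" if "(par ^^ a') i = (par ^^ b') j" for a' b'
    unfolding m_def by (rule Least_le) (use that in blast)
  have nzi: "(par ^^ r) i \<noteq> 0" if "r < a" for r
  proof
    assume 0: "(par ^^ r) i = 0"
    then have "(par ^^ a) i = 0" using par_funpow_antimono[of r a i] that by simp
    with 0 ab(2) have "(par ^^ r) i = (par ^^ b) j" by simp
    from least[OF this] that ab(1) show False by linarith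
  qed
  have nzj: "(par ^^ r) j \<noteq> 0" if "r < b" for r
  proof
    assume 0: "(par ^^ r) j = 0"
    then have "(par ^^ b) j = 0" using par_funpow_antimono[of r b j] that by simp
    with 0 ab(2) have "(par ^^ a) i = (par ^^ r) j" by simp
    from least[OF this] that ab(1) show False by linarith
  qed
  have top: "(par ^^ (a - 1)) i \<noteq> (par ^^ (b - 1)) j" if "0 < a" "0 < b"
    using least[of "a - 1" "b - 1"] ab(1) that by linarith
  have "0 < a + b"
  proof (rule ccontr)
    assume "\<not> 0 < a + b"
    with ab(2) assms(2) show False by simp
  qed
  moreover have "a + b \<le> s" using ab(1) ab0(1) \<open>m \<le> a0 + b0\<close> by linarith
  moreover have "\<forall>r<a. (par ^^ r) i \<noteq> 0" "\<forall>r<b. (par ^^ r) j \<noteq> 0"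
    "0 < a \<and> 0 < b \<longrightarrow> (par ^^ (a - 1)) i \<noteq> (par ^^ (b - 1)) j"
    using nzi nzj top by simp_all
  ultimately show thesis using ab(2) by (intro that)
qed

lemma source_funpow:
  assumes "\<And>r. r < a \<Longrightarrow> (par ^^ r) i \<noteq> 0" "r \<le> a"
  shows "source ((par ^^ (a - r)) i) \<longleftrightarrow> (even r = source ((par ^^ a) i))"
  using assms(2)
proof (induction r)
  case (Suc r)
  then have e: "a - r = Suc (a - Suc r)" by simp
  have "(par ^^ (a - Suc r)) i \<noteq> 0" using assms(1) Suc.prems by simp
  then have "source ((par ^^ (a - Suc r)) i) \<longleftrightarrow> \<not> source ((par ^^ (a - r)) i)"
    using source_par unfolding e by simp
  then show ?case using Suc by auto
qed simp

text \<open>The path between far vertices has more than \<open>2 l\<close> edges, so one of its two branches has more than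
  \<open>l\<close>. The first \<open>l\<close> ancestors on that branch lie strictly below the branching point and are not
  ancestors of the other end.\<close>

lemma far_imp_separate_ancestors:
  assumes "\<not> near (2 * l) i j"
  shows "(\<forall>r\<le>l. \<forall>a. (par ^^ a) i \<noteq> (par ^^ r) j) \<or> (\<forall>r\<le>l. \<forall>a. (par ^^ a) j \<noteq> (par ^^ r) i)"
proof (rule ccontr)
  assume "\<not> ?thesis"
  then obtain r a r' a' where
    1: "r \<le> l" "(par ^^ a) i = (par ^^ r) j" and 2: "r' \<le> l" "(par ^^ a') j = (par ^^ r') i"
    by blast
  have far: "l < a" if "r \<le> l" "(par ^^ a) i = (par ^^ r) j" for r a
    using assms that unfolding near_def by (metis add_mono le_less_linear mult_2)
  have far': "l < a" if "r \<le> l" "(par ^^ a) j = (par ^^ r) i" for r a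
    using assms that unfolding near_def by (metis add_mono le_less_linear mult_2)
  have "l < a" "l < a'" using far[OF 1] far'[OF 2] by auto
  then have "r' \<le> a" "r \<le> a'" using 1(1) 2(1) by linarith+
  from par_funpow_antimono[OF this(1), of i] par_funpow_antimono[OF this(2), of j]
  \<comment> \<open>Each of the two common ancestors is above the other, so they coincide.\<close>
  have "(par ^^ r') i = (par ^^ r) j" using 1(2) 2(2) by linarith
  with far[OF 1(1), of r'] 2(1) show False by simp
qed

text \<open>Balls around \<open>j\<close> in the subtree on the vertices up to \<open>j\<close> grow by at least one vertex per step
  until they exhaust it, because this subtree is connected.\<close>

lemma card_near:
  "card {i. i \<le> j \<and> near s i j} \<ge> min (Suc s) (Suc j)"
proof (induction s)
  case 0
  have "{j} \<subseteq> {i. i \<le> j \<and> near 0 i j}" by (auto simp: near_def)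
  from card_mono[OF _ this] show ?case by simp
next
  case (Suc s)
  let ?N = "\<lambda>s. {i. i \<le> j \<and> near s i j}"
  have sub: "?N s \<subseteq> ?N (Suc s)" unfolding near_def using le_SucI by blast
  show ?case
  proof (cases "\<forall>i\<le>j. near s i j")
    case True
    then have "?N (Suc s) = {..j}" using sub by auto
    then show ?thesis by simp
  next
    case False
    define i where "i = (LEAST i. i \<le> j \<and> \<not> near s i j)"
    have i: "i \<le> j" "\<not> near s i j"
      unfolding i_def by (rule LeastI2_ex; use False in auto)+
    have least: "near s i' j" if "i' < i" for i'
      using not_less_Least[of i' "\<lambda>i. i \<le> j \<and> \<not> near s i j"] that i(1) unfolding i_def by auto
    have "\<exists>i'. i' \<in> ?N (Suc s) - ?N s"
    proof (cases "i = 0")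
      case False
      then have "near s (par i) j" using least par_less by simp
      then obtain a b where "a + b \<le> s" "(par ^^ a) (par i) = (par ^^ b) j"
        unfolding near_def by blast
      then have "near (Suc s) i j" unfolding near_def
        by (intro exI[of _ "Suc a"] exI[of _ b]) (simp add: funpow_swap1)
      with i show ?thesis by blast
    next
      case True
      have nz: "(par ^^ b) j \<noteq> 0" if "b \<le> s" for b
        using i(2) that unfolding near_def True
        by (metis add.left_neutral funpow_0)
      have "near (Suc s) ((par ^^ Suc s) j) j"
        unfolding near_def by (intro exI[of _ 0] exI[of _ "Suc s"]) simp
      moreover have "\<not> near s ((par ^^ Suc s) j) j"
      proof
        assume "near s ((par ^^ Suc s) j) j"
        then obtain a b where ab: "a + b \<le> s" "(par ^^ a) ((par ^^ Suc s) j) = (par ^^ b) j"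
          unfolding near_def by blast
        then have "(par ^^ (a + Suc s)) j = (par ^^ b) j" by (simp only: funpow_add o_apply)
        moreover have "(par ^^ (a + Suc s)) j < (par ^^ b) j"
          using par_funpow_strict[of b "a + Suc s" j] nz[of b] ab(1) by simp
        ultimately show False by simp
      qed
      ultimately show ?thesis using par_funpow_le by blast
    qed
    with sub have "?N s \<subset> ?N (Suc s)" by blast
    then have "card (?N s) < card (?N (Suc s))"
      by (intro psubset_card_mono) auto
    with Suc show ?thesis by linarith
  qed
qed

definition far_pairs :: "nat \<Rightarrow> nat \<Rightarrow> (nat \<times> nat) set" where
  "far_pairs s n = {(i, j). i < j \<and> j \<le> n \<and> \<not> near s i j}"

lemma finite_far_pairs [simp]: "finite (far_pairs s n)"
proof -
  have "far_pairs s n \<subseteq> {..n} \<times> {..n}" unfolding far_pairs_def by auto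
  then show ?thesis by (rule finite_subset) simp
qed

text \<open>By \<open>card_near\<close>, at most \<open>j - s\<close> vertices before \<open>j\<close> are far from \<open>j\<close>. The bound is attained by
  paths.\<close>

lemma card_far_pairs: "2 * card (far_pairs s n) \<le> (n - s) * (n - s + 1)"
proof (induction n)
  case 0
  have "far_pairs s 0 = {}" by (auto simp: far_pairs_def)
  then show ?case by simp
next
  case (Suc n)
  let ?B = "{i. i < Suc n \<and> \<not> near s i (Suc n)}"
  have eq: "far_pairs s (Suc n) = far_pairs s n \<union> (\<lambda>i. (i, Suc n)) ` ?B"
    unfolding far_pairs_def by (auto simp: le_Suc_eq)
  have "card ?B \<le> Suc n - s"
  proof -
    have "{i. i \<le> Suc n \<and> near s i (Suc n)} \<union> ?B \<subseteq> {..Suc n}" by auto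
    then have "card ({i. i \<le> Suc n \<and> near s i (Suc n)} \<union> ?B) \<le> Suc (Suc n)"
      by (metis card_atMost card_mono finite_atMost)
    moreover have "card ({i. i \<le> Suc n \<and> near s i (Suc n)} \<union> ?B) =
      card {i. i \<le> Suc n \<and> near s i (Suc n)} + card ?B"
      by (intro card_Un_disjoint) auto
    ultimately show ?thesis using card_near[of s "Suc n"] by linarith
  qed
  moreover have "card (far_pairs s (Suc n)) \<le> card (far_pairs s n) + card ?B"
    unfolding eq by (rule order_trans[OF card_Un_le]) (simp add: card_image inj_on_def)
  ultimately have *: "2 * card (far_pairs s (Suc n)) \<le> (n - s) * (n - s + 1) + 2 * (Suc n - s)"
    using Suc by linarith
  show ?case
  proof (cases "s \<le> n")
    case True
    then have "Suc n - s = Suc (n - s)" by simp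
    with * show ?thesis by (simp add: algebra_simps)
  next
    case False
    then have "n - s = 0" "Suc n - s = 0" by auto
    with * show ?thesis by simp
  qed
qed

text \<open>The root is its own parent but not its own child.\<close>

definition children :: "nat \<Rightarrow> nat \<Rightarrow> nat set" where
  "children n i = {j. 0 < j \<and> j \<le> n \<and> par j = i}"

lemma finite_children [simp]: "finite (children n i)"
  unfolding children_def by simp

definition rank :: "nat \<Rightarrow> nat" where
  "rank i = card {j. 0 < j \<and> j < i \<and> par j = par i}"

lemma rank_strict: "i < j \<Longrightarrow> 0 < i \<Longrightarrow> par i = par j \<Longrightarrow> rank i < rank j"
  unfolding rank_def by (rule psubset_card_mono) auto

lemma rank_inj: "0 < i \<Longrightarrow> 0 < j \<Longrightarrow> par i = par j \<Longrightarrow> rank i = rank j \<Longrightarrow> i = j"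
  using rank_strict[of i j] rank_strict[of j i] by (cases i j rule: linorder_cases) auto

lemma rank_less: "0 < i \<Longrightarrow> i \<le> n \<Longrightarrow> rank i < card (children n (par i))"
  unfolding rank_def children_def by (rule psubset_card_mono) auto

definition max_degree_le :: "nat \<Rightarrow> nat \<Rightarrow> bool" where
  "max_degree_le n d \<longleftrightarrow> (\<forall>i\<le>n. card (children n i) + (if i = 0 then 0 else 1) \<le> d)"

text \<open>Recursion down the tree in which the image of a vertex depends on the images of its parent and
  its grandparent.\<close>

function unfolding_along :: "'v \<Rightarrow> (nat \<Rightarrow> 'v \<Rightarrow> 'v \<Rightarrow> 'v) \<Rightarrow> nat \<Rightarrow> 'v" where
  "unfolding_along v step i = (if i = 0 then v else
     step i (unfolding_along v step (par i)) (unfolding_along v step (par (par i))))"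
  by auto
termination
proof (relation "measure (\<lambda>(_, _, i). i)")
  fix v :: 'v and step :: "nat \<Rightarrow> 'v \<Rightarrow> 'v \<Rightarrow> 'v" and i :: nat
  assume "i \<noteq> 0"
  then have "par i < i" by (simp add: par_less)
  then show "((v, step, par i), v, step, i) \<in> measure (\<lambda>(_, _, i). i)"
    and "((v, step, par (par i)), v, step, i) \<in> measure (\<lambda>(_, _, i). i)"
    using par_le[of "par i"] by simp_all
qed simp

declare unfolding_along.simps [simp del]

end

section \<open>Locally injective maps and copies\<close>

locale numbering_in_host = host A d l + numbering par source
  for A :: "'b rel" and d l :: nat and par source
begin

definition copy :: "nat \<Rightarrow> (nat \<Rightarrow> 'b) \<Rightarrow> bool" where
  "copy n f \<longleftrightarrow> inj_on f {..n} \<and> (\<forall>i. 0 < i \<and> i \<le> n \<longrightarrow> f i \<in> nbs (source (par i)) (f (par i)))"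

text \<open>The neighbours of each tree vertex have distinct images: a child avoids its grandparent and its
  siblings.\<close>

definition locally_injective :: "nat \<Rightarrow> (nat \<Rightarrow> 'b) \<Rightarrow> bool" where
  "locally_injective n f \<longleftrightarrow>
     (\<forall>i. 0 < i \<and> i \<le> n \<longrightarrow> f i \<in> nbs (source (par i)) (f (par i))) \<and>
     (\<forall>i. par i \<noteq> 0 \<and> i \<le> n \<longrightarrow> f i \<noteq> f (par (par i))) \<and>
     (\<forall>i j. 0 < i \<and> 0 < j \<and> i \<le> n \<and> j \<le> n \<and> i \<noteq> j \<and> par i = par j \<longrightarrow> f i \<noteq> f j)"

text \<open>The two lemmas on descents say that the image of a descending path of the tree is an alternating
  walk without backtracking.\<close>

lemma descent_step:
  assumes "locally_injective n f" "i \<le> n" "\<And>r. r < a \<Longrightarrow> (par ^^ r) i \<noteq> 0" "r < a"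
  shows "f ((par ^^ (a - Suc r)) i) \<in> nbs (even r = source ((par ^^ a) i)) (f ((par ^^ (a - r)) i))"
proof -
  let ?z = "(par ^^ (a - Suc r)) i"
  have "?z \<noteq> 0" using assms(3)[of "a - Suc r"] assms(4) by simp
  moreover have "?z \<le> n" using par_funpow_le assms(2) by (rule order_trans)
  ultimately have "f ?z \<in> nbs (source (par ?z)) (f (par ?z))"
    using assms(1) by (auto simp: locally_injective_def)
  moreover have "par ?z = (par ^^ (a - r)) i"
    unfolding Suc_diff_Suc[OF assms(4), symmetric] by simp
  moreover have "source ((par ^^ (a - r)) i) \<longleftrightarrow> (even r = source ((par ^^ a) i))"
    by (rule source_funpow) (use assms(3,4) in auto)
  ultimately show ?thesis by simp
qed

lemma descent_nonback:
  assumes "locally_injective n f" "i \<le> n" "\<And>r. r < a \<Longrightarrow> (par ^^ r) i \<noteq> 0" "r + 2 \<le> a"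
  shows "f ((par ^^ (a - r)) i) \<noteq> f ((par ^^ (a - (r + 2))) i)"
proof -
  let ?z = "(par ^^ (a - (r + 2))) i"
  have e: "a - Suc r = Suc (a - (r + 2))" "a - r = Suc (a - Suc r)" using assms(4) by auto
  have "par ?z = (par ^^ (a - Suc r)) i" unfolding e by simp
  moreover have "par (par ?z) = (par ^^ (a - r)) i" unfolding e by simp
  moreover have "(par ^^ (a - Suc r)) i \<noteq> 0" using assms(3)[of "a - Suc r"] assms(4) by simp
  moreover have "?z \<le> n" using par_funpow_le assms(2) by (rule order_trans)
  moreover have "f z \<noteq> f (par (par z))" if "par z \<noteq> 0" "z \<le> n" for z
    using assms(1) that unfolding locally_injective_def by blast
  ultimately show ?thesis by metis
qed

text \<open>The tree path between the two vertices is mapped to two alternating walks that diverge at the image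
  of the common ancestor.\<close>

lemma near_images_distinct:
  assumes f: "locally_injective n f" and "i \<le> n" "j \<le> n" "i \<noteq> j" "near (2 * l) i j"
  shows "f i \<noteq> f j"
proof -
  obtain a b where ab: "0 < a + b" "a + b \<le> 2 * l" and meet: "(par ^^ a) i = (par ^^ b) j"
    and nz': "\<forall>r<a. (par ^^ r) i \<noteq> 0" "\<forall>r<b. (par ^^ r) j \<noteq> 0"
    and diff': "0 < a \<and> 0 < b \<longrightarrow> (par ^^ (a - 1)) i \<noteq> (par ^^ (b - 1)) j"
    by (rule near_obtains_path[OF assms(5,4)])
  have nz: "\<And>r. r < a \<Longrightarrow> (par ^^ r) i \<noteq> 0" "\<And>r. r < b \<Longrightarrow> (par ^^ r) j \<noteq> 0"
    and diff: "0 < a \<Longrightarrow> 0 < b \<Longrightarrow> (par ^^ (a - 1)) i \<noteq> (par ^^ (b - 1)) j"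
    using nz' diff' by blast+
  define x where "x r = f ((par ^^ (a - r)) i)" for r
  define y where "y r = f ((par ^^ (b - r)) j)" for r
  have "x a \<noteq> y b"
  proof (rule diverging_walks_do_not_meet[where out = "source ((par ^^ a) i)"])
    show "x (Suc r) \<in> nbs (even r = source ((par ^^ a) i)) (x r)" if "r < a" for r
      unfolding x_def using descent_step[OF f \<open>i \<le> n\<close> nz(1) that] .
    show "y (Suc r) \<in> nbs (even r = source ((par ^^ a) i)) (y r)" if "r < b" for r
      unfolding y_def meet using descent_step[OF f \<open>j \<le> n\<close> nz(2) that] .
    show "x r \<noteq> x (r + 2)" if "r + 2 \<le> a" for r
      unfolding x_def using descent_nonback[OF f \<open>i \<le> n\<close> nz(1) that] .
    show "y r \<noteq> y (r + 2)" if "r + 2 \<le> b" for r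
      unfolding y_def using descent_nonback[OF f \<open>j \<le> n\<close> nz(2) that] .
    show "x 0 = y 0" by (simp add: x_def y_def meet)
    show "x 1 \<noteq> y 1" if "0 < a" "0 < b"
    proof -
      have "par ((par ^^ (a - 1)) i) = (par ^^ a) i" "par ((par ^^ (b - 1)) j) = (par ^^ b) j"
        using that funpow.simps(2)[of "a - 1" par] funpow.simps(2)[of "b - 1" par] by simp_all
      moreover have "(par ^^ (a - 1)) i \<noteq> 0" "(par ^^ (b - 1)) j \<noteq> 0" using nz that by simp_all
      moreover have "(par ^^ (a - 1)) i \<le> n" "(par ^^ (b - 1)) j \<le> n"
        using par_funpow_le[of "a - 1" i] par_funpow_le[of "b - 1" j] assms(2,3) by linarith+
      ultimately show ?thesis
        using f diff[OF that] meet unfolding locally_injective_def x_def y_def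
        by (metis neq0_conv)
    qed
  qed (use ab in auto)
  then show ?thesis by (simp add: x_def y_def)
qed

text \<open>When vertex \<open>Suc n\<close> is added, the vertices in use other than the image of its parent are at most
  \<open>n < d\<close> in number, so they cannot fill the neighbourhood of that image.\<close>

lemma greedy_copy:
  assumes arc: "v \<in> nbs (source 0) u" and "n \<le> d"
  shows "\<exists>f. copy n f"
  using \<open>n \<le> d\<close>
proof (induction n)
  case 0
  have "copy 0 (\<lambda>_. u)" by (auto simp: copy_def inj_on_def)
  then show ?case by blast
next
  case (Suc n)
  then obtain f where f: "copy n f" by auto
  have fu: "f i \<in> nbs (source (par i)) (f (par i))" if "0 < i" "i \<le> n" for i
    using f that by (simp add: copy_def)
  let ?p = "par (Suc n)"
  have p: "?p \<le> n" using par_less[of "Suc n"] by simp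
  show ?case
  proof (cases "n = 0")
    case True
    have "u \<noteq> v" using arc not_self_nbs by metis
    have "?p = 0" using p True by simp
    have 1: "i = 0 \<or> i = 1" if "i \<le> Suc n" for i using that True by linarith
    have "inj_on (\<lambda>i. if i = 0 then u else v) {..Suc n}"
      using 1 \<open>u \<noteq> v\<close> by (intro inj_onI) (auto split: if_splits)
    moreover have "i = Suc n" if "0 < i" "i \<le> Suc n" for i using that True by simp
    ultimately have "copy (Suc n) (\<lambda>i. if i = 0 then u else v)"
      using arc \<open>?p = 0\<close> unfolding copy_def by (metis (full_types) neq0_conv)
    then show ?thesis by blast
  next
    case False
    obtain z where "z \<in> nbs (source ?p) (f ?p)"
    proof (cases "?p = 0")
      case True
      have "par 1 = 0" using par_less[of 1] by simp
      with fu[of 1] False that True show thesis by simp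
    next
      case False
      then have "f ?p \<in> nbs (source (par ?p)) (f (par ?p))" using fu p by simp
      then have "f (par ?p) \<in> nbs (source ?p) (f ?p)"
        using nbs_flip[of "f ?p"] source_par[of ?p] False by simp
      then show thesis by (rule that)
    qed
    then have "d \<le> card (nbs (source ?p) (f ?p))" by (rule card_nbs)
    moreover have "card (f ` ({..n} - {?p})) \<le> n"
      using card_image_le[of "{..n} - {?p}" f] p by simp
    ultimately have "card (f ` ({..n} - {?p})) < card (nbs (source ?p) (f ?p))"
      using Suc.prems by linarith
    then have "\<not> nbs (source ?p) (f ?p) \<subseteq> f ` ({..n} - {?p})"
      by (metis card_mono finite_Diff finite_atMost finite_imageI not_less)
    then obtain w where w: "w \<in> nbs (source ?p) (f ?p)" "w \<notin> f ` ({..n} - {?p})" by blast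
    then have "w \<notin> f ` {..n}" by auto
    have "copy (Suc n) (f(Suc n := w))"
      unfolding copy_def
    proof (intro conjI allI impI)
      show "inj_on (f(Suc n := w)) {..Suc n}"
        using f \<open>w \<notin> f ` {..n}\<close> unfolding copy_def atMost_Suc
        by (simp add: inj_on_def image_iff) (metis atMost_iff)
      show "(f(Suc n := w)) i \<in> nbs (source (par i)) ((f(Suc n := w)) (par i))"
        if "0 < i \<and> i \<le> Suc n" for i
      proof (cases "i = Suc n")
        case True then show ?thesis using w(1) p by simp
      next
        case False
        then have "i \<le> n" using that by simp
        moreover have "par i \<noteq> Suc n" using par_le[of i] \<open>i \<le> n\<close> by simp
        ultimately show ?thesis using fu that False by simp
      qed
    qed
    then show ?thesis by blast
  qed
qed

end

section \<open>Union bound over random locally injective maps\<close>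

lemma mod_add_left_inj:
  fixes b c m :: nat
  assumes "(a + b) mod m = (a + c) mod m" "b < m" "c < m"
  shows "b = c"
proof -
  have *: "b = c" if "b \<le> c" "(a + b) mod m = (a + c) mod m" "c < m" for b c
  proof -
    have "m dvd (a + c) - (a + b)"
      using that(1) mod_eq_dvd_iff_nat[of "a + b" "a + c" m] that(2)[symmetric] by simp
    then have "m dvd c - b" by simp
    then show ?thesis using that by (auto dest: dvd_imp_le)
  qed
  show ?thesis using *[of b c] *[of c b] assms by (cases "b \<le> c") auto
qed

text \<open>With \<open>x = d - 2\<close> this is twice the comparison of the bound on the number of far pairs with
  \<open>(d - 1)\<^sup>l\<close>. It fails for \<open>l = 2\<close> and large \<open>x\<close>.\<close>

lemma far_pairs_bound_less_power:
  fixes x :: nat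
  assumes "3 \<le> l" "1 \<le> x"
  shows "l * x * (l * x + 1) < 2 * (1 + x) ^ l"
  using assms(1)
proof (induction l rule: dec_induct)
  case base
  have "9 * x ^ 2 + 3 * x < 2 * (1 + x) ^ 3"
  proof -
    obtain y where y: "x = y + 1" using assms(2) by (metis add.commute le_Suc_ex One_nat_def)
    show ?thesis unfolding y by (simp add: power2_eq_square power3_eq_cube algebra_simps)
  qed
  then show ?case by (simp add: power2_eq_square algebra_simps)
next
  case (step l)
  have "Suc l * x * (Suc l * x + 1) \<le> (1 + x) * (l * x * (l * x + 1))"
  proof -
    obtain y where y: "x = y + 1" using assms(2) by (metis add.commute le_Suc_ex One_nat_def)
    obtain m where m: "l = m + 3" using step(1) by (metis add.commute le_Suc_ex)
    have "Suc l * (Suc l * x + 1) \<le> (1 + x) * (l * (l * x + 1))"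
      unfolding y m by (simp add: algebra_simps)
    then have "x * (Suc l * (Suc l * x + 1)) \<le> x * ((1 + x) * (l * (l * x + 1)))"
      by (rule mult_le_mono2)
    then show ?thesis by (simp only: mult.assoc mult.commute mult.left_commute)
  qed
  also have "\<dots> < (1 + x) * (2 * (1 + x) ^ l)"
    using step.IH by (intro mult_strict_left_mono) auto
  finally show ?case by (simp add: mult_ac)
qed

context numbering_in_host
begin

context
  fixes u :: 'b and m n :: nat
    and first :: "nat \<Rightarrow> 'b" and next_nb :: "bool \<Rightarrow> 'b \<Rightarrow> 'b \<Rightarrow> nat \<Rightarrow> 'b"
  assumes m_def: "Suc m = d" and m_pos: "0 < m"
    and first: "inj_on first {..<d}" "first ` {..<d} \<subseteq> nbs (source 0) u"
    and next_nb: "\<And>out v w. w \<in> nbs out v \<Longrightarrow> inj_on (next_nb out v w) {..<m}"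
      "\<And>out v w. w \<in> nbs out v \<Longrightarrow> next_nb out v w ` {..<m} \<subseteq> nbs out v - {w}"
    and degree: "max_degree_le n d"
begin

text \<open>The children of a vertex take consecutive candidates, starting at a position that depends on the
  shift \<open>t\<close> of that vertex; a single shift suffices since siblings only have to differ. The root has no
  parent to avoid and may have \<open>d\<close> children, so its children are placed without a shift.\<close>

definition shifted_map :: "(nat \<Rightarrow> nat) \<Rightarrow> nat \<Rightarrow> 'b" where
  "shifted_map t = unfolding_along u (\<lambda>i v w. if par i = 0 then first (rank i)
     else next_nb (source (par i)) v w ((rank i + t (par i)) mod m))"

lemma shifted_map_0: "shifted_map t 0 = u"
  unfolding shifted_map_def by (subst unfolding_along.simps) simp

lemma shifted_map_child_of_root: "0 < i \<Longrightarrow> par i = 0 \<Longrightarrow> shifted_map t i = first (rank i)"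
  unfolding shifted_map_def by (subst unfolding_along.simps) simp

lemma shifted_map_later: "par i \<noteq> 0 \<Longrightarrow> shifted_map t i =
   next_nb (source (par i)) (shifted_map t (par i)) (shifted_map t (par (par i)))
     ((rank i + t (par i)) mod m)"
  unfolding shifted_map_def by (subst unfolding_along.simps) (auto intro: gr0I)

lemma rank_less_d: "0 < i \<Longrightarrow> i \<le> n \<Longrightarrow> rank i < d"
  using rank_less[of i n] degree par_le[of i] unfolding max_degree_le_def
  by (meson add_leD1 le_trans less_le_trans)

lemma rank_less_m:
  assumes "par i \<noteq> 0" "i \<le> n" shows "rank i < m"
proof -
  have "0 < i" using assms by (cases "i = 0") auto
  then have "rank i < card (children n (par i))" using rank_less assms by simp
  moreover have "par i \<le> n" using par_le[of i] assms(2) by simp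
  then have "card (children n (par i)) + 1 \<le> d"
    using degree assms unfolding max_degree_le_def by auto
  ultimately show ?thesis using m_def by simp
qed

lemma shifted_map_arc:
  assumes "0 < i" "i \<le> n"
  shows "shifted_map t i \<in> nbs (source (par i)) (shifted_map t (par i))"
  using assms
proof (induction i rule: less_induct)
  case (less i)
  show ?case
  proof (cases "par i = 0")
    case True
    then show ?thesis
      using first rank_less_d less.prems by (auto simp: shifted_map_child_of_root shifted_map_0)
  next
    case False
    then have "shifted_map t (par i) \<in> nbs (source (par (par i))) (shifted_map t (par (par i)))"
      using less par_less[of i] by simp
    then have "shifted_map t (par (par i)) \<in> nbs (source (par i)) (shifted_map t (par i))"
      using nbs_flip[of "shifted_map t (par i)"] source_par[of "par i"] False by simp
    from next_nb(2)[OF this] show ?thesis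
      unfolding shifted_map_later[OF False] using m_pos by (auto simp: image_subset_iff)
  qed
qed

lemma grandparent_nbs:
  assumes "par i \<noteq> 0" "i \<le> n"
  shows "shifted_map t (par (par i)) \<in> nbs (source (par i)) (shifted_map t (par i))"
proof -
  have "shifted_map t (par i) \<in> nbs (source (par (par i))) (shifted_map t (par (par i)))"
    using shifted_map_arc[of "par i"] assms par_le[of i] by simp
  then show ?thesis
    using nbs_flip[of "shifted_map t (par i)"] source_par[of "par i"] assms by simp
qed

lemma shifted_map_locally_injective: "locally_injective n (shifted_map t)"
proof -
  have "shifted_map t i \<noteq> shifted_map t (par (par i))" if "par i \<noteq> 0" "i \<le> n" for i
    using next_nb(2)[OF grandparent_nbs[OF that, of t]] m_pos
    unfolding shifted_map_later[OF that(1)] by (auto simp: image_subset_iff)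
  moreover have "shifted_map t i \<noteq> shifted_map t j"
    if ij: "0 < i" "0 < j" "i \<le> n" "j \<le> n" "i \<noteq> j" "par i = par j" for i j
  proof
    assume eq: "shifted_map t i = shifted_map t j"
    show False
    proof (cases "par i = 0")
      case True
      then have "first (rank i) = first (rank j)"
        using eq ij by (simp add: shifted_map_child_of_root)
      then have "rank i = rank j"
        using inj_onD[OF first(1)] rank_less_d ij by simp
      then show False using rank_inj ij by blast
    next
      case False
      have "(rank i + t (par i)) mod m = (rank j + t (par i)) mod m"
        using inj_onD[OF next_nb(1)[OF grandparent_nbs[OF False \<open>i \<le> n\<close>, of t]]] eq m_pos
        unfolding shifted_map_later[OF False] shifted_map_later[OF False[unfolded ij(6)]] ij(6)
        by simp
      then have "rank i = rank j"
        using mod_add_left_inj[of "t (par i)" "rank i" m "rank j"] rank_less_m ij False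
        by (simp add: add.commute)
      then show False using rank_inj ij by blast
    qed
  qed
  ultimately show ?thesis
    using shifted_map_arc unfolding locally_injective_def by blast
qed

text \<open>The image of a vertex is determined by the shifts of its proper ancestors.\<close>

lemma shifted_map_cong:
  assumes "\<And>r. 0 < r \<Longrightarrow> t ((par ^^ r) i) = t' ((par ^^ r) i)"
  shows "shifted_map t i = shifted_map t' i"
  using assms
proof (induction i rule: less_induct)
  case (less i)
  have up: "t ((par ^^ r) ((par ^^ s) i)) = t' ((par ^^ r) ((par ^^ s) i))" if "0 < r" for r s
    using less.prems[of "r + s"] that by (simp add: funpow_add)
  show ?case
  proof (cases "par i = 0")
    case True
    then show ?thesis
      by (cases "i = 0") (auto simp: shifted_map_0 shifted_map_child_of_root)
  next
    case False
    then have i: "0 < i" by (cases "i = 0") auto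
    have "shifted_map t (par i) = shifted_map t' (par i)"
      using less.IH[of "par i"] par_less[OF i] up[of _ 1] by simp
    moreover have "shifted_map t (par (par i)) = shifted_map t' (par (par i))"
      using less.IH[of "par (par i)"] par_less[OF i] par_le[of "par i"] up[of _ 2]
      by (simp add: numeral_2_eq_2)
    moreover have "t (par i) = t' (par i)" using less.prems[of 1] by simp
    ultimately show ?thesis unfolding shifted_map_later[OF False] by simp
  qed
qed

text \<open>Consider the topmost of the \<open>l\<close> last ancestors of \<open>j\<close> at which two choices of shifts differ. Both
  maps agree there and at its parent, but send its child on the way to \<open>j\<close> to different vertices; the
  two walks down to \<open>j\<close> diverge there and cannot meet again within \<open>l\<close> steps.\<close>

lemma shifted_map_inj_on_ancestor_shifts:
  assumes "j \<le> n" and nz: "(par ^^ l) j \<noteq> 0"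
    and t: "t \<in> {..n} \<rightarrow>\<^sub>E {..<m}" and t': "t' \<in> {..n} \<rightarrow>\<^sub>E {..<m}"
    and agree: "\<And>i. i \<notin> (\<lambda>r. (par ^^ r) j) ` {1..l} \<Longrightarrow> t i = t' i"
    and eq: "shifted_map t j = shifted_map t' j"
  shows "t = t'"
proof (rule ccontr)
  assume "t \<noteq> t'"
  let ?D = "{r \<in> {1..l}. t ((par ^^ r) j) \<noteq> t' ((par ^^ r) j)}"
  obtain i where "t i \<noteq> t' i" using \<open>t \<noteq> t'\<close> by blast
  with agree[of i] obtain r where "r \<in> {1..l}" "i = (par ^^ r) j" by blast
  with \<open>t i \<noteq> t' i\<close> have "r \<in> ?D" by blast
  then have "?D \<noteq> {}" by blast
  \<comment> \<open>Larger exponents are higher up in the tree.\<close>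
  define R where "R = Max ?D"
  have R: "R \<in> ?D" unfolding R_def by (rule Max_in) (use \<open>?D \<noteq> {}\<close> in auto)
  have above: "t ((par ^^ r) j) = t' ((par ^^ r) j)" if "R < r" for r
  proof (cases "r \<le> l")
    case True
    show ?thesis
    proof (rule ccontr)
      assume "t ((par ^^ r) j) \<noteq> t' ((par ^^ r) j)"
      with True R that have "r \<in> ?D" by auto
      then have "r \<le> R" unfolding R_def by (intro Max_ge) auto
      with that show False by simp
    qed
  next
    case False
    have "(par ^^ r) j \<noteq> (par ^^ r') j" if "r' \<in> {1..l}" for r'
    proof -
      have "(par ^^ r) j < (par ^^ l) j" using False nz by (intro par_funpow_strict) auto
      also have "\<dots> \<le> (par ^^ r') j" using that by (intro par_funpow_antimono) auto
      finally show ?thesis by simp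
    qed
    then have "(par ^^ r) j \<notin> (\<lambda>r. (par ^^ r) j) ` {1..l}" by blast
    then show ?thesis by (rule agree)
  qed
  let ?x = "\<lambda>t r. shifted_map t ((par ^^ (R - r)) j)"
  have nzR: "(par ^^ r) j \<noteq> 0" if "r \<le> R" for r
    using par_funpow_antimono[of r l j] that R nz by auto
  have same: "shifted_map t ((par ^^ s) j) = shifted_map t' ((par ^^ s) j)" if "R \<le> s" for s
    by (rule shifted_map_cong) (use above that in \<open>simp flip: funpow_add[unfolded fun_eq_iff o_apply, rule_format]\<close>)
  have step: "?x s (Suc r) \<in> nbs (even r = source ((par ^^ R) j)) (?x s r)" if "r < R" for r s
    using descent_step[OF shifted_map_locally_injective \<open>j \<le> n\<close> _ that] nzR by simp
  have nonback: "?x s r \<noteq> ?x s (r + 2)" if "r + 2 \<le> R" for r s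
    using descent_nonback[OF shifted_map_locally_injective \<open>j \<le> n\<close> _ that] nzR by simp
  have "?x t R \<noteq> ?x t' R"
  proof (rule diverging_walks_do_not_meet[OF step step nonback nonback])
    show "?x t 0 = ?x t' 0" using same by simp
    show "?x t 1 \<noteq> ?x t' 1"
    proof
      assume eq1: "?x t 1 = ?x t' 1"
      let ?z = "(par ^^ (R - 1)) j"
      have pz: "par ?z = (par ^^ R) j"
        using R funpow.simps(2)[of "R - 1" par] by simp
      have ppz: "par (par ?z) = (par ^^ Suc R) j" unfolding pz by simp
      have pz0: "par ?z \<noteq> 0" using nzR[of R] pz by simp
      have zn: "?z \<le> n" using par_funpow_le \<open>j \<le> n\<close> by (rule order_trans)
      have s1: "shifted_map t' (par ?z) = shifted_map t (par ?z)"
        unfolding pz using same[of R] by simp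
      have s2: "shifted_map t' (par (par ?z)) = shifted_map t (par (par ?z))"
        unfolding ppz using same[of "Suc R"] by simp
      have "(rank ?z + t (par ?z)) mod m = (rank ?z + t' (par ?z)) mod m"
        using inj_onD[OF next_nb(1)[OF grandparent_nbs[OF pz0 zn, of t]]] eq1 m_pos
        unfolding shifted_map_later[OF pz0] s1 s2 by simp
      moreover have "t (par ?z) < m" "t' (par ?z) < m"
        using t t' par_le[of ?z] zn by (auto simp: PiE_iff)
      ultimately have "t (par ?z) = t' (par ?z)" by (rule mod_add_left_inj)
      then show False using R pz by simp
    qed
  qed (use R in auto)
  with eq show False by simp
qed

text \<open>The probability of a collision is at most \<open>m\<close> to the power \<open>- l\<close>: fixing all shifts except those
  of the last \<open>l\<close> ancestors of \<open>j\<close> fixes the image of \<open>i\<close>, and then at most one choice of the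
  remaining shifts sends \<open>j\<close> there.\<close>

lemma card_collisions:
  assumes "i \<le> n" "j \<le> n" and sep: "\<And>r a. r \<le> l \<Longrightarrow> (par ^^ a) i \<noteq> (par ^^ r) j"
  shows "card {t \<in> {..n} \<rightarrow>\<^sub>E {..<m}. shifted_map t i = shifted_map t j} * m ^ l \<le> m ^ Suc n"
proof -
  let ?C = "{t \<in> {..n} \<rightarrow>\<^sub>E {..<m}. shifted_map t i = shifted_map t j}"
  let ?Y = "(\<lambda>r. (par ^^ r) j) ` {1..l}"
  have nz: "(par ^^ r) j \<noteq> 0" if "r \<le> l" for r
    using sep[of r i] that par_funpow_reaches_0[of i i] by simp
  have "inj_on (\<lambda>r. (par ^^ r) j) {1..l}"
  proof (rule inj_onI)
    fix r s assume rs: "r \<in> {1..l}" "s \<in> {1..l}" "(par ^^ r) j = (par ^^ s) j"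
    then show "r = s"
      using par_funpow_strict[of r s j] par_funpow_strict[of s r j] nz[of r] nz[of s]
      by (cases r s rule: linorder_cases) auto
  qed
  then have cardY: "card ?Y = l" by (simp add: card_image)
  have Yn: "?Y \<subseteq> {..n}" using par_funpow_le \<open>j \<le> n\<close> order_trans by blast
  have inj: "inj_on (\<lambda>t. restrict t ({..n} - ?Y)) ?C"
  proof (rule inj_onI)
    fix t t' assume t: "t \<in> ?C" and t': "t' \<in> ?C"
      and r: "restrict t ({..n} - ?Y) = restrict t' ({..n} - ?Y)"
    have agree: "t s = t' s" if "s \<notin> ?Y" for s
    proof (cases "s \<le> n")
      case True
      then show ?thesis using fun_cong[OF r, of s] that by (simp add: restrict_def split: if_splits)
    next
      case False
      then have "t s = undefined" "t' s = undefined" using t t' by (auto simp: PiE_def extensional_def)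
      then show ?thesis by simp
    qed
    have "shifted_map t i = shifted_map t' i"
    proof (rule shifted_map_cong)
      fix r
      have "(par ^^ r) i \<notin> ?Y" using sep by auto
      then show "t ((par ^^ r) i) = t' ((par ^^ r) i)" by (rule agree)
    qed
    then have "shifted_map t j = shifted_map t' j" using t t' by simp
    with \<open>j \<le> n\<close> nz[of l] t t' agree show "t = t'"
      by (intro shifted_map_inj_on_ancestor_shifts[of j t t']) auto
  qed
  have "(\<lambda>t. restrict t ({..n} - ?Y)) ` ?C \<subseteq> ({..n} - ?Y) \<rightarrow>\<^sub>E {..<m}"
    by (intro image_subsetI iffD2[OF restrict_PiE_iff]) (auto simp: PiE_iff)
  moreover have "finite (({..n} - ?Y) \<rightarrow>\<^sub>E {..<m})" by (intro finite_PiE) auto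
  ultimately have "card ?C \<le> card (({..n} - ?Y) \<rightarrow>\<^sub>E {..<m})"
    using inj card_inj_on_le by blast
  also have "\<dots> = m ^ (Suc n - l)"
    using Yn cardY by (simp add: card_PiE card_Diff_subset)
  finally have "card ?C * m ^ l \<le> m ^ (Suc n - l) * m ^ l" by (rule mult_le_mono1)
  also have "l \<le> Suc n" using card_mono[OF _ Yn] cardY by simp
  then have "m ^ (Suc n - l) * m ^ l = m ^ Suc n" by (simp flip: power_add)
  finally show ?thesis .
qed

lemma some_shift_is_injective:
  assumes few: "card (far_pairs (2 * l) n) < m ^ l"
  shows "\<exists>t. inj_on (shifted_map t) {..n}"
proof -
  let ?\<Omega> = "{..n} \<rightarrow>\<^sub>E {..<m}"
  let ?C = "\<lambda>(i, j). {t \<in> ?\<Omega>. shifted_map t i = shifted_map t j}"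
  let ?F = "far_pairs (2 * l) n"
  have fin: "finite ?\<Omega>" by (intro finite_PiE) auto
  \<comment> \<open>For each far pair at least one of its two ends can take the role of \<open>j\<close> in the count.\<close>
  have cardC: "card (?C p) * m ^ l \<le> m ^ Suc n" if "p \<in> ?F" for p
  proof -
    obtain i j where p: "p = (i, j)" by (cases p)
    have ij: "i \<le> n" "j \<le> n" "\<not> near (2 * l) i j" using that unfolding p far_pairs_def by auto
    have swap: "{t \<in> ?\<Omega>. shifted_map t i = shifted_map t j} =
      {t \<in> ?\<Omega>. shifted_map t j = shifted_map t i}" by auto
    from far_imp_separate_ancestors[OF ij(3)] show ?thesis
    proof
      assume "\<forall>r\<le>l. \<forall>a. (par ^^ a) i \<noteq> (par ^^ r) j"
      then show ?thesis unfolding p using card_collisions[of i j] ij by simp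
    next
      assume "\<forall>r\<le>l. \<forall>a. (par ^^ a) j \<noteq> (par ^^ r) i"
      then show ?thesis unfolding p using card_collisions[of j i] ij swap by simp
    qed
  qed
  have "card (\<Union>p\<in>?F. ?C p) * m ^ l \<le> (\<Sum>p\<in>?F. card (?C p)) * m ^ l"
    by (intro mult_le_mono1 card_UN_le) simp
  also have "\<dots> = (\<Sum>p\<in>?F. card (?C p) * m ^ l)" by (simp add: sum_distrib_right)
  also have "\<dots> \<le> (\<Sum>p\<in>?F. m ^ Suc n)" by (rule sum_mono) (rule cardC)
  also have "\<dots> = card ?F * m ^ Suc n" by simp
  also have "\<dots> < m ^ l * m ^ Suc n" using few m_pos by simp
  finally have "card (\<Union>p\<in>?F. ?C p) < m ^ Suc n" by (simp add: mult.commute)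
  also have "m ^ Suc n = card ?\<Omega>" by (simp add: card_PiE)
  finally have "card (\<Union>p\<in>?F. ?C p) < card ?\<Omega>" .
  moreover have "finite (\<Union>p\<in>?F. ?C p)" by (rule finite_subset[OF _ fin]) auto
  ultimately have "\<not> ?\<Omega> \<subseteq> (\<Union>p\<in>?F. ?C p)"
    using card_mono[of "\<Union>p\<in>?F. ?C p" ?\<Omega>] by linarith
  then obtain t where t: "t \<in> ?\<Omega>" "t \<notin> (\<Union>p\<in>?F. ?C p)" by blast
  have less: "shifted_map t i \<noteq> shifted_map t j" if "i < j" "j \<le> n" for i j
  proof (cases "near (2 * l) i j")
    case True
    then show ?thesis
      using near_images_distinct[OF shifted_map_locally_injective, of i j t] that by simp
  next
    case False
    then have "(i, j) \<in> ?F" using that by (simp add: far_pairs_def)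
    with t show ?thesis by blast
  qed
  have "inj_on (shifted_map t) {..n}"
  proof (rule inj_onI)
    fix i j assume "i \<in> {..n}" "j \<in> {..n}" "shifted_map t i = shifted_map t j"
    then show "i = j" using less[of i j] less[of j i] by (cases i j rule: linorder_cases) auto
  qed
  then show ?thesis by blast
qed

end

lemma copy_if_girth_large:
  assumes arc: "v \<in> nbs (source 0) u" and "max_degree_le n d"
    and "n \<le> l * d" "3 \<le> l" "2 \<le> d"
  shows "\<exists>f. copy n f"
proof -
  define m where "m = d - 1"
  have m: "Suc m = d" "0 < m" using \<open>2 \<le> d\<close> by (auto simp: m_def)
  have enum: "\<exists>g. inj_on g {..<k} \<and> g ` {..<k} \<subseteq> B" if "finite B" "k \<le> card B"
    for k and B :: "'b set"
  proof -
    obtain g where "bij_betw g {..<card B} B"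
      using ex_bij_betw_nat_finite[OF \<open>finite B\<close>] by (auto simp: atLeast0LessThan)
    then show ?thesis using \<open>k \<le> card B\<close>
      by (intro exI[of _ g]) (auto simp: bij_betw_def intro: inj_on_subset)
  qed
  obtain first where first: "inj_on first {..<d}" "first ` {..<d} \<subseteq> nbs (source 0) u"
    using enum[OF finite_nbs card_nbs[OF arc]] by blast
  define next_nb where "next_nb out v w =
    (SOME g. inj_on g {..<m} \<and> g ` {..<m} \<subseteq> nbs out v - {w})" for out v w
  have "inj_on (next_nb out v w) {..<m} \<and> next_nb out v w ` {..<m} \<subseteq> nbs out v - {w}"
    if "w \<in> nbs out v" for out v w
  proof -
    have "m \<le> card (nbs out v - {w})" using card_nbs[OF that] that by (simp add: m_def)
    then have "\<exists>g. inj_on g {..<m} \<and> g ` {..<m} \<subseteq> nbs out v - {w}"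
      by (intro enum) auto
    then show ?thesis unfolding next_nb_def by (rule someI_ex)
  qed
  then have "\<And>out v w. w \<in> nbs out v \<Longrightarrow> inj_on (next_nb out v w) {..<m}"
    and "\<And>out v w. w \<in> nbs out v \<Longrightarrow> next_nb out v w ` {..<m} \<subseteq> nbs out v - {w}"
    by blast+
  note S = m first this assms(2)
  have "card (far_pairs (2 * l) n) < m ^ l"
  proof (cases "m = 1")
    case True
    then have "d = 2" using m(1) by simp
    then have "n - 2 * l = 0" using assms(3) by simp
    then have "2 * card (far_pairs (2 * l) n) \<le> 0" using card_far_pairs[of "2 * l" n] by simp
    then show ?thesis using True by simp
  next
    case False
    define x where "x = m - 1"
    have x: "1 \<le> x" "m = 1 + x" "d = x + 2" using False m by (auto simp: x_def)
    have "n - 2 * l \<le> l * x" using assms(3) unfolding x by (simp add: algebra_simps)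
    then have "(n - 2 * l) * (n - 2 * l + 1) \<le> l * x * (l * x + 1)" by (intro mult_le_mono) auto
    then have "2 * card (far_pairs (2 * l) n) < 2 * m ^ l"
      using card_far_pairs[of "2 * l" n] far_pairs_bound_less_power[OF \<open>3 \<le> l\<close> x(1)] unfolding x(2)
      by linarith
    then show ?thesis by simp
  qed
  from some_shift_is_injective[OF S this] obtain t where
    t: "inj_on (shifted_map u m first next_nb t) {..n}" by blast
  moreover have "locally_injective n (shifted_map u m first next_nb t)"
    by (rule shifted_map_locally_injective[OF S])
  ultimately have "copy n (shifted_map u m first next_nb t)"
    unfolding copy_def locally_injective_def by blast
  then show ?thesis by blast
qed

end

section \<open>Adding a star when only cycles of length at most four are excluded\<close>

context numbering
begin

definition adj :: "nat \<Rightarrow> nat \<Rightarrow> bool" where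
  "adj i j \<longleftrightarrow> (0 < j \<and> par j = i) \<or> (0 < i \<and> par i = j)"

lemma adj_sym: "adj i j \<longleftrightarrow> adj j i"
  by (auto simp: adj_def)

lemma adj_irrefl [simp]: "\<not> adj i i"
  using par_less[of i] by (auto simp: adj_def)

lemma adj_source: "adj i j \<Longrightarrow> source i \<longleftrightarrow> \<not> source j"
  using source_par[of i] source_par[of j] by (auto simp: adj_def)

text \<open>Connectedness of the tree on the vertices up to \<open>n\<close>: every vertex is joined to the root by its
  ancestors.\<close>

lemma adj_closed_is_everything:
  assumes "x \<in> X" "x \<le> n" and closed: "\<And>i j. i \<in> X \<Longrightarrow> adj i j \<Longrightarrow> j \<le> n \<Longrightarrow> j \<in> X"
    and "i \<le> n"
  shows "i \<in> X"
proof -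
  have "(par ^^ r) x \<in> X" for r
  proof (induction r)
    case (Suc r)
    show ?case
    proof (cases "(par ^^ r) x = 0")
      case True then show ?thesis using Suc by simp
    next
      case False
      then have "adj ((par ^^ r) x) ((par ^^ Suc r) x)" by (simp add: adj_def)
      moreover have "(par ^^ Suc r) x \<le> n" using par_funpow_le[of "Suc r" x] \<open>x \<le> n\<close> by linarith
      ultimately show ?thesis using closed Suc by blast
    qed
  qed (use assms in simp)
  from this[of x] have "0 \<in> X" using par_funpow_reaches_0[of x x] by simp
  then show ?thesis using \<open>i \<le> n\<close>
  proof (induction i rule: less_induct)
    case (less i)
    show ?case
    proof (cases "i = 0")
      case False
      then have "par i \<in> X" using less par_less[of i] by simp
      moreover have "adj (par i) i" using False by (simp add: adj_def)
      ultimately show ?thesis using closed less.prems by blast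
    qed (use less in simp)
  qed
qed

end

context numbering_in_host
begin

lemma copy_adj:
  assumes "copy n f" "adj i j" "i \<le> n" "j \<le> n"
  shows "f i \<in> nbs (source j) (f j)"
proof -
  have arc: "f i \<in> nbs (source (par i)) (f (par i))" if "0 < i" "i \<le> n" for i
    using assms(1) that by (simp add: copy_def)
  show ?thesis
    using assms(2) unfolding adj_def
  proof
    assume j: "0 < j \<and> par j = i"
    then have "f j \<in> nbs (source i) (f i)" using arc[of j] assms(4) by simp
    then show ?thesis using nbs_flip[of "f j"] source_par[of j] j by simp
  next
    assume "0 < i \<and> par i = j"
    then show ?thesis using arc[of i] assms(3) by simp
  qed
qed

text \<open>The situation before the \<open>c\<close> leaves at \<open>p\<close> are added. The leaves \<open>L\<close> attached to \<open>q\<close>, among them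
  \<open>p\<close>, are interchangeable and do not count as occupying their images; \<open>H = f ` ({..n} - L)\<close> is
  what remains. The proof charges disjoint subsets \<open>P x\<close> of \<open>H - {f q}\<close> to the neighbours \<open>x\<close> of
  \<open>f q\<close>: if \<open>x\<close> lies in \<open>H\<close>, then \<open>x\<close> itself and its neighbours in \<open>H\<close>, which are at least two
  vertices because the tree vertex at \<open>x\<close> has a neighbour other than \<open>q\<close>; otherwise the neighbours of
  \<open>x\<close> in \<open>H\<close>, which are at least \<open>d - c\<close> vertices if fewer than \<open>c\<close> neighbours of \<open>x\<close> are unused.
  There are at least \<open>d\<close> neighbours \<open>x\<close>, and \<open>n + c \<le> 2 d\<close> leaves no room for this, except
  that for \<open>d - c = 1\<close> it remains possible that no \<open>x\<close> lies in \<open>H\<close>. Then all neighbours of \<open>q\<close>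
  belong to \<open>L\<close>, so by connectedness \<open>H\<close> is just \<open>{f q}\<close> and blocks nothing.\<close>

lemma room_for_star:
  assumes "2 \<le> l" and f: "copy n f" and "n + c \<le> 2 * d" "0 < c" "c < d"
    and p: "0 < p" "p \<le> n" and q: "q = par p"
    and leaf: "\<And>j. j \<le> n \<Longrightarrow> adj p j \<Longrightarrow> j = q"
    and L: "L = {s. s \<le> n \<and> adj s q \<and> (\<forall>j\<le>n. adj s j \<longrightarrow> j = q)}"
  shows "\<exists>u \<in> nbs (source q) (f q) - f ` ({..n} - L).
    c \<le> card (nbs (\<not> source q) u - {f q} - f ` ({..n} - L))"
proof (rule ccontr)
  let ?v = "f q" and ?o = "source q"
  let ?H = "f ` ({..n} - L)"
  let ?N = "nbs ?o ?v"
  assume "\<not> ?thesis"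
  then have few: "card (nbs (\<not> ?o) u - {?v} - ?H) < c" if "u \<in> ?N" "u \<notin> ?H" for u
    using that not_le by blast
  have inj: "inj_on f {..n}" using f by (simp add: copy_def)
  have feq: "f i = f j \<Longrightarrow> i = j" if "i \<le> n" "j \<le> n" for i j
    using inj_onD[OF inj] that by simp
  have pq: "adj p q" "q \<le> n" using p q par_less[of p] by (auto simp: adj_def)
  have pL: "p \<in> L" unfolding L using p pq leaf by blast
  have "q \<notin> L" unfolding L by simp
  then have vH: "?v \<in> ?H" using pq by blast
  have fpN: "f p \<in> ?N" using copy_adj[OF f pq(1)] p pq by simp
  have fpH: "f p \<notin> ?H" using pL feq p by auto
  define P where "P x = (if x \<in> ?H
      then insert x {y \<in> ?H - {?v}. \<exists>out. y \<in> nbs out x}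
      else {y \<in> ?H - {?v}. y \<in> nbs (\<not> ?o) x})" for x
  have finH: "finite ?H" by simp
  have PH: "P x \<subseteq> ?H - {?v}" if "x \<in> ?N" for x
    using that unfolding P_def by auto
  have disj: "P x \<inter> P x' = {}" if "x \<in> ?N" "x' \<in> ?N" "x \<noteq> x'" for x x'
  proof (rule ccontr)
    assume "P x \<inter> P x' \<noteq> {}"
    then obtain e where e: "e \<in> P x" "e \<in> P x'" by blast
    have "e \<noteq> ?v" using PH[OF that(1)] e by auto
    have "e = x \<or> (\<exists>out. e \<in> nbs out x)" "e = x' \<or> (\<exists>out. e \<in> nbs out x')"
      using e unfolding P_def by (auto split: if_splits)
    then consider "e = x" "e = x'" | out where "e = x" "e \<in> nbs out x'"
      | out where "e = x'" "e \<in> nbs out x"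
      | out out' where "e \<in> nbs out x" "e \<in> nbs out' x'" by blast
    then show False
    proof cases
      case 1 then show False using that by simp
    next
      case 2 then show False using no_triangle[OF \<open>2 \<le> l\<close> that(2,1)] by metis
    next
      case 3 then show False using no_triangle[OF \<open>2 \<le> l\<close> that(1,2)] by metis
    next
      case 4 then show False by (rule no_square[OF \<open>2 \<le> l\<close> that _ _ \<open>e \<noteq> ?v\<close>])
    qed
  qed
  have P2: "2 \<le> card (P w)" if w: "w \<in> ?N" "w \<in> ?H" for w
  proof -
    obtain s where s: "w = f s" "s \<le> n" "s \<notin> L" using w(2) by auto
    have "s \<noteq> q" using w(1) s by auto
    \<comment> \<open>If \<open>s\<close> is adjacent to \<open>q\<close>, it has another neighbour since it is not in \<open>L\<close>.\<close>
    have "\<exists>j\<le>n. adj s j \<and> j \<noteq> q"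
    proof (cases "adj s q")
      case True
      then show ?thesis using s unfolding L by blast
    next
      case False
      have "\<exists>j\<le>n. adj s j"
      proof (cases "s = 0")
        case True
        have "par 1 = 0" using par_less[of 1] by simp
        then have "adj s 1" "1 \<le> n" using True p by (auto simp: adj_def)
        then show ?thesis by blast
      next
        case False
        then have "adj s (par s)" "par s \<le> n"
          using par_le[of s] s by (auto simp: adj_def)
        then show ?thesis by blast
      qed
      with False show ?thesis by blast
    qed
    then obtain j where j: "j \<le> n" "adj s j" "j \<noteq> q" by blast
    have "j \<notin> L" using adj_sym[of s j] j s \<open>s \<noteq> q\<close> unfolding L by blast
    have "f j \<noteq> ?v" using feq[of j q] j pq by auto
    have "f j \<in> nbs (source s) w"
      using copy_adj[OF f, of j s] adj_sym[of s j] j s by simp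
    then have "f j \<noteq> w" using not_self_nbs by metis
    have "{w, f j} \<subseteq> P w"
      using w \<open>j \<notin> L\<close> j \<open>f j \<noteq> ?v\<close> \<open>f j \<in> nbs (source s) w\<close> unfolding P_def by auto
    moreover have "finite (P w)" using PH[OF w(1)] finH by (meson finite_Diff finite_subset)
    ultimately have "card {w, f j} \<le> card (P w)" by (rule card_mono[rotated])
    then show ?thesis using \<open>f j \<noteq> w\<close> by simp
  qed
  have Pdc: "d - c \<le> card (P u)" if u: "u \<in> ?N" "u \<notin> ?H" for u
  proof -
    have v: "?v \<in> nbs (\<not> ?o) u" using u(1) nbs_flip[of u] by simp
    have "nbs (\<not> ?o) u \<subseteq> insert ?v ((nbs (\<not> ?o) u - {?v} - ?H) \<union> P u)"
      using u unfolding P_def by auto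
    moreover have fin: "finite (P u)" using PH[OF u(1)] finH by (meson finite_Diff finite_subset)
    ultimately have "card (nbs (\<not> ?o) u) \<le> card (insert ?v ((nbs (\<not> ?o) u - {?v} - ?H) \<union> P u))"
      by (intro card_mono) auto
    also have "\<dots> \<le> Suc (card (nbs (\<not> ?o) u - {?v} - ?H) + card (P u))"
      using card_Un_le[of "nbs (\<not> ?o) u - {?v} - ?H" "P u"] by (simp add: card_insert_if fin)
    finally show ?thesis using card_nbs[OF v] few[OF u] by linarith
  qed
  let ?W1 = "?N \<inter> ?H" and ?W2 = "?N - ?H"
  have "(\<Sum>x\<in>?N. card (P x)) = card (\<Union>x\<in>?N. P x)"
    using PH finH disj by (intro card_UN_disjoint[symmetric]) (auto intro: finite_subset)
  also have "\<dots> \<le> card (?H - {?v})"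
    using PH finH by (intro card_mono) auto
  also have "\<dots> = card ({..n} - L) - 1"
    using vH card_image[OF inj_on_subset[OF inj, of "{..n} - L"]] by simp
  also have "\<dots> = n - card L"
  proof -
    have "L \<subseteq> {..n}" unfolding L by auto
    then show ?thesis by (simp add: card_Diff_subset finite_subset)
  qed
  finally have le: "(\<Sum>x\<in>?N. card (P x)) \<le> n - card L" .
  have split: "?N = ?W1 \<union> ?W2" by auto
  have "(\<Sum>x\<in>?N. card (P x)) = (\<Sum>x\<in>?W1. card (P x)) + (\<Sum>x\<in>?W2. card (P x))"
    by (subst split, rule sum.union_disjoint) auto
  also have "\<dots> \<ge> (\<Sum>x\<in>?W1. 2) + (\<Sum>x\<in>?W2. d - c)"
    by (intro add_mono sum_mono P2 Pdc) auto
  finally have ge: "2 * card ?W1 + (d - c) * card ?W2 \<le> (\<Sum>x\<in>?N. card (P x))"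
    by (simp add: mult.commute)
  have "card ?N = card ?W1 + card ?W2"
    by (subst split, rule card_Un_disjoint) auto
  then have N: "d \<le> card ?W1 + card ?W2" using card_nbs[OF fpN] by simp
  have "finite L" unfolding L by simp
  then have "0 < card L" using pL by (auto simp: card_gt_0_iff)
  show False
  proof (cases "d - c = 1")
    case False
    then have "2 * card ?W2 \<le> (d - c) * card ?W2" using \<open>c < d\<close> by (intro mult_right_mono) auto
    then show False using ge le N assms(3,4) \<open>0 < card L\<close> by linarith
  next
    case True
    then have "2 * card ?W1 + card ?W2 \<le> n - card L" using ge le by simp
    then have "card ?W1 = 0" using N assms(3,5) True \<open>0 < card L\<close> by linarith
    then have W1: "?W1 = {}" by simp
    have closed: "j \<in> insert q L" if "i \<in> insert q L" "adj i j" "j \<le> n" for i j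
    proof (cases "i = q")
      case True
      then have "adj j q" using that adj_sym by simp
      then have "f j \<in> ?N" using copy_adj[OF f] that pq by simp
      then have "f j \<notin> ?H" using W1 by blast
      then show ?thesis using that by blast
    next
      case False
      then show ?thesis using that unfolding L by blast
    qed
    have "{..n} \<subseteq> insert q L"
      using adj_closed_is_everything[of q "insert q L" n] closed pq by blast
    then have "?H \<subseteq> {?v}" by auto
    then have "P (f p) = {}" using PH[OF fpN] by blast
    then show False using Pdc[OF fpN fpH] True by simp
  qed
qed

text \<open>Place \<open>p\<close> at \<open>u\<close>, put the leaf that may occupy \<open>u\<close> at the old place of \<open>p\<close>, and send the new
  leaves to unused neighbours of \<open>u\<close>. These do not meet the images of \<open>L\<close>, since a common neighbour
  of \<open>u\<close> and \<open>f q\<close> would form a nondirected triangle.\<close>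

lemma add_star:
  assumes "2 \<le> l" and f: "copy n f"
    and p: "0 < p" "p \<le> n" and q: "q = par p"
    and leaf: "\<And>j. j \<le> n \<Longrightarrow> adj p j \<Longrightarrow> j = q"
    and L: "L = {s. s \<le> n \<and> adj s q \<and> (\<forall>j\<le>n. adj s j \<longrightarrow> j = q)}"
    and u: "u \<in> nbs (source q) (f q)" "u \<notin> f ` ({..n} - L)"
    and room: "c \<le> card (nbs (\<not> source q) u - {f q} - f ` ({..n} - L))"
    and star: "\<And>i. n < i \<Longrightarrow> i \<le> n + c \<Longrightarrow> par i = p"
  shows "\<exists>f. copy (n + c) f"
proof -
  let ?v = "f q" and ?o = "source q"
  let ?H = "f ` ({..n} - L)"
  have inj: "inj_on f {..n}" using f by (simp add: copy_def)
  have feq: "f i = f j \<Longrightarrow> i = j" if "i \<le> n" "j \<le> n" for i j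
    using inj_onD[OF inj] that by simp
  have pq: "adj p q" "q \<le> n" using p q par_less[of p] by (auto simp: adj_def)
  have pL: "p \<in> L" unfolding L using p pq leaf by blast
  have qL: "q \<notin> L" unfolding L by simp
  have src: "source p \<longleftrightarrow> \<not> ?o" using adj_source[OF pq(1)] by simp
  have fL: "f s \<in> nbs ?o ?v" if "s \<in> L" for s
  proof -
    from that have "s \<le> n" "adj s q" unfolding L by blast+
    with copy_adj[OF f] pq show ?thesis by blast
  qed
  let ?R = "nbs (\<not> ?o) u - {?v} - ?H"
  have "card {n<..n + c} \<le> card ?R" using room by simp
  then obtain g where g: "g ` {n<..n + c} \<subseteq> ?R" "inj_on g {n<..n + c}"
    using card_le_inj[of "{n<..n + c}" ?R] by auto
  have gR: "g i \<in> nbs (\<not> ?o) u" "g i \<notin> ?H" if "i \<in> {n<..n + c}" for i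
    using g(1) that by blast+
  define f1 where "f1 i = (if i = p then u else if f i = u then f p else f i)" for i
  have f1H: "f1 i = f i" if "i \<le> n" "i \<notin> L" for i
    using that pL u(2) by (auto simp: f1_def)
  have f1L: "f1 i \<in> nbs ?o ?v" if "i \<in> L" for i
    using fL[OF that] fL[OF pL] u(1) by (auto simp: f1_def)
  have f1_p: "f1 i = u \<longleftrightarrow> i = p" if "i \<le> n" for i
    using feq[OF that p(2)] by (auto simp: f1_def)
  have inj1: "inj_on f1 {..n}"
  proof (rule inj_onI)
    fix i j assume ij: "i \<in> {..n}" "j \<in> {..n}" "f1 i = f1 j"
    show "i = j"
    proof (cases "i = p \<or> j = p")
      case True
      then show ?thesis using f1_p[of i] f1_p[of j] ij by auto
    next
      case False
      then have "f i = f j \<or> f i = f p \<or> f j = f p"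
        using ij(3) unfolding f1_def by metis
      then show ?thesis using feq[of i j] feq[of i p] feq[of j p] p ij False by auto
    qed
  qed
  have gf1: "g i \<noteq> f1 j" if "i \<in> {n<..n + c}" "j \<le> n" for i j
  proof (cases "j \<in> L")
    case True
    show ?thesis using gR(1)[OF that(1)] no_triangle[OF \<open>2 \<le> l\<close> u(1) f1L[OF True]] by metis
  next
    case False
    then have "f1 j \<in> ?H" using f1H[OF that(2) False] that(2) by simp
    then show ?thesis using gR(2)[OF that(1)] by metis
  qed
  define f2 where "f2 i = (if n < i then g i else f1 i)" for i
  have inj2: "inj_on f2 {..n + c}"
  proof (rule inj_onI)
    fix i j assume "i \<in> {..n + c}" "j \<in> {..n + c}" "f2 i = f2 j"
    then show "i = j"
      using inj_onD[OF g(2), of i j] inj_onD[OF inj1, of i j] gf1[of i j] gf1[of j i]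
      unfolding f2_def by (auto split: if_splits)
  qed
  have "f2 i \<in> nbs (source (par i)) (f2 (par i))" if i: "0 < i" "i \<le> n + c" for i
  proof (cases "n < i")
    case True
    then have "f2 (par i) = u" using star[OF True i(2)] p by (simp add: f2_def f1_def)
    moreover have "g i \<in> nbs (\<not> ?o) u" using gR(1)[of i] True i by simp
    ultimately show ?thesis using True star[OF True i(2)] src by (simp add: f2_def)
  next
    case False
    have par_n: "par i \<le> n" using par_le[of i] False by simp
    have e: "f2 i = f1 i" "f2 (par i) = f1 (par i)" using False par_n by (auto simp: f2_def)
    have ad: "adj i (par i)" using i by (simp add: adj_def)
    have f1q: "f1 q = ?v" using f1H[of q] qL pq by simp
    consider "i \<in> L" | "i \<notin> L" "par i \<in> L" | "i \<notin> L" "par i \<notin> L" by blast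
    then show ?thesis
    proof cases
      case 1
      then have "par i = q" using ad par_n unfolding L by blast
      then show ?thesis using f1L[OF 1] f1q e by simp
    next
      case 2
      then have "i = q" using ad adj_sym[of i] False unfolding L by auto
      then show ?thesis
        using f1L[OF 2(2)] nbs_flip[of "f1 (par i)"] adj_source[OF ad] f1q e by simp
    next
      case 3
      then have "f1 i = f i" "f1 (par i) = f (par i)" using f1H False par_n by auto
      then show ?thesis using f i False e by (simp add: copy_def)
    qed
  qed
  with inj2 have "copy (n + c) f2" by (simp add: copy_def)
  then show ?thesis by blast
qed

text \<open>In breadth-first order the children of the last parent \<open>p\<close> are exactly the last vertices and are
  leaves, so removing them leaves an initial segment of the numbering.\<close>

lemma copy_if_no_short_cycle:
  assumes arc: "v \<in> nbs (source 0) u" and "2 \<le> l" "max_degree_le n d" "n \<le> 2 * d"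
    and "\<And>i j. 0 < i \<Longrightarrow> i \<le> j \<Longrightarrow> j \<le> n \<Longrightarrow> par i \<le> par j"
  shows "\<exists>f. copy n f"
  using assms(3-5)
proof (induction n rule: less_induct)
  case (less n)
  show ?case
  proof (cases "n \<le> d")
    case True
    then show ?thesis by (rule greedy_copy[OF arc])
  next
    case False
    define p where "p = par n"
    define C where "C = children n p"
    have "n \<in> C" using False by (simp add: C_def children_def p_def)
    have "finite C" by (simp add: C_def)
    define n' where "n' = Min C - 1"
    have "Min C \<in> C" using \<open>n \<in> C\<close> \<open>finite C\<close> by (intro Min_in) auto
    then have MC: "0 < Min C" "Min C \<le> n" "par (Min C) = p" by (auto simp: C_def children_def)
    then have n': "Suc n' = Min C" "n' < n" by (auto simp: n'_def)
    have star: "par i = p" if "n' < i" "i \<le> n" for i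
    proof (rule antisym)
      show "par i \<le> p" using less.prems(3)[of i n] that by (simp add: p_def)
      show "p \<le> par i" using less.prems(3)[of "Min C" i] MC n' that by simp
    qed
    have C: "C = {n'<..n}"
    proof
      show "C \<subseteq> {n'<..n}"
      proof
        fix i assume "i \<in> C"
        then have "Min C \<le> i" "i \<le> n"
          using Min_le[OF \<open>finite C\<close>] by (auto simp: C_def children_def)
        then show "i \<in> {n'<..n}" using n'(1) by simp
      qed
      show "{n'<..n} \<subseteq> C" using star by (auto simp: C_def children_def)
    qed
    define c where "c = n - n'"
    have c: "card C = c" "n' + c = n" "0 < c" using n' by (auto simp: C c_def)
    have "p \<noteq> 0"
    proof
      assume "p = 0"
      then have "par i = 0" if "0 < i" "i \<le> n" for i
        using less.prems(3)[of i n] that by (simp add: p_def)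
      then have "{1..n} \<subseteq> C" using \<open>p = 0\<close> by (auto simp: C_def children_def)
      then have "card {1..n} \<le> card C" by (rule card_mono[OF \<open>finite C\<close>])
      then have "n \<le> c" using c by simp
      moreover have "c \<le> d" using less.prems(1) c \<open>p = 0\<close>
        unfolding max_degree_le_def C_def by auto
      ultimately show False using False by simp
    qed
    have p: "0 < p" "p \<le> n'" using \<open>p \<noteq> 0\<close> par_less[of "Min C"] MC n' by auto
    have deg: "card (children n i) + (if i = 0 then 0 else 1) \<le> d" if "i \<le> n" for i
      using less.prems(1) that unfolding max_degree_le_def by blast
    have "c < d" using deg[of p] c(1) p n'(2) unfolding C_def by simp
    have "max_degree_le n' d"
      unfolding max_degree_le_def
    proof (intro allI impI)
      fix i assume "i \<le> n'"
      have "card (children n' i) \<le> card (children n i)"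
        using n' by (intro card_mono) (auto simp: children_def)
      then show "card (children n' i) + (if i = 0 then 0 else 1) \<le> d"
        using deg[of i] \<open>i \<le> n'\<close> n'(2) by linarith
    qed
    moreover have "n' \<le> 2 * d" using less.prems(2) n'(2) by linarith
    moreover have "par i \<le> par j" if "0 < i" "i \<le> j" "j \<le> n'" for i j
      using less.prems(3)[of i j] that n'(2) by simp
    ultimately obtain f where f: "copy n' f"
      using less.IH[OF n'(2)] by blast
    define q where "q = par p"
    have leaf: "j = q" if "j \<le> n'" "adj p j" for j
    proof (rule ccontr)
      assume "j \<noteq> q"
      with that(2) have "0 < j" "par j = p" by (auto simp: adj_def q_def)
      then have "j \<in> C" using that(1) n'(2) by (simp add: C_def children_def)
      then show False using that(1) unfolding C by simp
    qed
    define L where "L = {s. s \<le> n' \<and> adj s q \<and> (\<forall>j\<le>n'. adj s j \<longrightarrow> j = q)}"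
    obtain u where "u \<in> nbs (source q) (f q)" "u \<notin> f ` ({..n'} - L)"
      "c \<le> card (nbs (\<not> source q) u - {f q} - f ` ({..n'} - L))"
      using room_for_star[OF \<open>2 \<le> l\<close> f _ \<open>0 < c\<close> \<open>c < d\<close> p q_def leaf L_def] less.prems(2)
      unfolding c(2) by blast
    from add_star[OF \<open>2 \<le> l\<close> f p q_def leaf L_def this] star
    have "\<exists>f. copy (n' + c) f" unfolding c(2) by blast
    then show ?thesis unfolding c(2) .
  qed
qed

end

context numbering_in_host
begin

text \<open>If \<open>l = 1\<close> then \<open>n \<le> d\<close>. If \<open>l \<ge> 3\<close> and \<open>n > d\<close>, a tree with two edges forces \<open>d \<ge> 2\<close>, so that
  at least one candidate remains when the parent is avoided.\<close>

theorem copy_exists: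
  assumes arc: "v \<in> nbs (source 0) u" and "1 \<le> l" and degree: "max_degree_le n d"
    and n: "n \<le> l * d"
    and mono: "\<And>i j. 0 < i \<Longrightarrow> i \<le> j \<Longrightarrow> j \<le> n \<Longrightarrow> par i \<le> par j"
  shows "\<exists>f. copy n f"
proof -
  consider "n \<le> d" | "l = 2" | "3 \<le> l" "d < n"
    using \<open>1 \<le> l\<close> n by (cases "l = 1") force+
  then show ?thesis
  proof cases
    case 1
    then show ?thesis by (rule greedy_copy[OF arc])
  next
    case 2
    then show ?thesis using copy_if_no_short_cycle[OF arc _ degree _ mono] n by simp
  next
    case 3
    have deg: "card (children n i) + (if i = 0 then 0 else 1) \<le> d" if "i \<le> n" for i
      using degree that unfolding max_degree_le_def by blast
    have "2 \<le> d"
    proof (cases "n = 1")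
      case True
      then show ?thesis using n 3 by simp
    next
      case False
      have "par 1 = 0" using par_less[of 1] by simp
      consider "par 2 = 0" | "par 2 = 1" using par_less[of 2] by linarith
      then show ?thesis
      proof cases
        case 1
        then have "{1, 2} \<subseteq> children n 0" using 3 False \<open>par 1 = 0\<close> by (auto simp: children_def)
        then have "card {1, 2 :: nat} \<le> card (children n 0)" by (rule card_mono[OF finite_children])
        then show ?thesis using deg[of 0] by simp
      next
        case 2
        then have "2 \<in> children n 1" using 3 False by (auto simp: children_def)
        then have "0 < card (children n 1)" by (auto simp: card_gt_0_iff)
        then show ?thesis using deg[of 1] 3 by simp
      qed
    qed
    then show ?thesis using copy_if_girth_large[OF arc degree n 3(1)] by simp
  qed
qed

end

section \<open>Nondirected cycles and degrees in the host digraph\<close>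

lemma oarc_degree:
  assumes "pair_digraph D" "oarc (parcs D) out v w"
  shows "min_pseudo_semidegree D \<le> card {w. oarc (parcs D) out v w}"
proof -
  interpret pair_digraph D by fact
  have ne: "parcs D \<noteq> {}" using assms(2) by (auto simp: oarc_def split: if_splits)
  have v: "v \<in> pverts D" using assms(2) by (auto simp: oarc_def dest: wellformed' split: if_splits)
  show ?thesis
  proof (cases out)
    case True
    have "out_arcs (with_proj D) v = Pair v ` {w. (v, w) \<in> parcs D}"
      by (force simp: out_arcs_def)
    then have deg: "out_degree (with_proj D) v = card {w. (v, w) \<in> parcs D}"
      by (simp add: out_degree_def card_image inj_on_def)
    have "finite (Pair v ` {w. (v, w) \<in> parcs D})"
      by (rule finite_subset[OF _ pair_finite_arcs]) auto
    then have "finite {w. (v, w) \<in> parcs D}"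
      by (rule finite_imageD) (simp add: inj_on_def)
    moreover have "w \<in> {w. (v, w) \<in> parcs D}" using assms(2) True by (simp add: oarc_def)
    ultimately have "0 < out_degree (with_proj D) v"
      unfolding deg by (auto simp: card_gt_0_iff)
    then have "Min {out_degree (with_proj D) v |v. v \<in> pverts D \<and> 0 < out_degree (with_proj D) v}
        \<le> out_degree (with_proj D) v"
      using v pair_finite_verts by (intro Min_le) auto
    then show ?thesis using ne True deg by (simp add: min_pseudo_semidegree_def oarc_def)
  next
    case False
    have "in_arcs (with_proj D) v = (\<lambda>w. (w, v)) ` {w. (w, v) \<in> parcs D}"
      by (force simp: in_arcs_def)
    then have deg: "in_degree (with_proj D) v = card {w. (w, v) \<in> parcs D}"
      by (simp add: in_degree_def card_image inj_on_def)
    have "finite ((\<lambda>w. (w, v)) ` {w. (w, v) \<in> parcs D})"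
      by (rule finite_subset[OF _ pair_finite_arcs]) auto
    then have "finite {w. (w, v) \<in> parcs D}"
      by (rule finite_imageD) (simp add: inj_on_def)
    moreover have "w \<in> {w. (w, v) \<in> parcs D}" using assms(2) False by (simp add: oarc_def)
    ultimately have "0 < in_degree (with_proj D) v"
      unfolding deg by (auto simp: card_gt_0_iff)
    then have "Min {in_degree (with_proj D) v |v. v \<in> pverts D \<and> 0 < in_degree (with_proj D) v}
        \<le> in_degree (with_proj D) v"
      using v pair_finite_verts by (intro Min_le) auto
    then show ?thesis using ne False deg by (simp add: min_pseudo_semidegree_def oarc_def)
  qed
qed

text \<open>The orientation of the cycle through \<open>0, \<dots>, n - 1\<close> in which the step from \<open>r\<close> is taken forwards iff
  \<open>out r\<close>.\<close>

definition cycle_digraph :: "nat \<Rightarrow> (nat \<Rightarrow> bool) \<Rightarrow> nat pair_pre_digraph" where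
  "cycle_digraph n out = \<lparr>pverts = {..<n},
     parcs = (\<lambda>r. if out r then (r, Suc r mod n) else (Suc r mod n, r)) ` {..<n}\<rparr>"

lemma directed_cycle_digraph:
  assumes "3 \<le> n" shows "directed_cycle (cycle_digraph n (\<lambda>_. True))"
  unfolding directed_cycle_def
proof (intro exI[of _ "[0..<n]"] conjI)
  have "set (zip [0..<n] (rotate1 [0..<n])) = (\<lambda>i. ([0..<n] ! i, rotate1 [0..<n] ! i)) ` {..<n}"
    by (auto simp: set_zip simp del: nth_upt)
  also have "\<dots> = (\<lambda>r. (r, Suc r mod n)) ` {..<n}"
    by (rule image_cong) (auto simp: nth_rotate1)
  finally have "set (zip [0..<n] (rotate1 [0..<n])) = (\<lambda>r. (r, Suc r mod n)) ` {..<n}" .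
  then show "cycle_digraph n (\<lambda>_. True) =
      \<lparr>pverts = set [0..<n], parcs = set (zip [0..<n] (rotate1 [0..<n]))\<rparr>"
    by (simp add: cycle_digraph_def atLeast0LessThan)
qed (use assms in auto)

lemma mk_symmetric_cycle_digraph:
  "mk_symmetric (with_proj (cycle_digraph n out)) =
   \<lparr>pverts = {..<n}, parcs = (\<Union>r<n. {(r, Suc r mod n), (Suc r mod n, r)})\<rparr>"
  by (auto simp: mk_symmetric_def cycle_digraph_def split: if_splits)

lemma oriented_cycle_digraph:
  assumes "3 \<le> n" shows "oriented_cycle (cycle_digraph n out)"
proof -
  let ?U = "mk_symmetric (with_proj (cycle_digraph n out))"
  have U: "?U = mk_symmetric (with_proj (cycle_digraph n (\<lambda>_. True)))"
    by (simp add: mk_symmetric_cycle_digraph)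
  have S: "Suc r mod n = (if Suc r = n then 0 else Suc r)" if "r < n" for r
    using that by auto
  have "pair_graph ?U"
    unfolding mk_symmetric_cycle_digraph
  proof unfold_locales
    show "symmetric (with_proj \<lparr>pverts = {..<n},
        parcs = \<Union>r<n. {(r, Suc r mod n), (Suc r mod n, r)}\<rparr>)"
      by (auto simp: symmetric_def intro!: symI)
  qed (use assms in \<open>auto simp: S split: if_splits\<close>)
  moreover have "asym (parcs (cycle_digraph n out))"
    by (rule asymI) (use assms in \<open>auto simp: cycle_digraph_def S split: if_splits\<close>)
  ultimately have "orientation_of (cycle_digraph n out) ?U"
    unfolding orientation_of_def by simp
  moreover have "undirected_cycle ?U"
    unfolding undirected_cycle_def U using directed_cycle_digraph[OF assms] by blast
  ultimately show ?thesis unfolding oriented_cycle_def by blast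
qed

text \<open>In a directed cycle no vertex has two outgoing or two ingoing arcs, but vertex \<open>1\<close> does.\<close>

lemma not_directed_cycle_digraph:
  assumes "3 \<le> n" "out 0 \<noteq> out 1" shows "\<not> directed_cycle (cycle_digraph n out)"
proof
  assume "directed_cycle (cycle_digraph n out)"
  then obtain vs where vs: "distinct vs"
    and arcs: "parcs (cycle_digraph n out) = set (zip vs (rotate1 vs))"
    unfolding directed_cycle_def by auto
  have functional: "y = y'" if "(x, y) \<in> set (zip vs (rotate1 vs))"
    "(x, y') \<in> set (zip vs (rotate1 vs))" for x y y'
    using that vs by (auto simp: set_zip nth_eq_iff_index_eq)
  have injective: "x = x'" if "(x, y) \<in> set (zip vs (rotate1 vs))"
    "(x', y) \<in> set (zip vs (rotate1 vs))" for x x' y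
  proof -
    have "distinct (rotate1 vs)" using vs by simp
    then show ?thesis using that by (auto simp: set_zip nth_eq_iff_index_eq)
  qed
  have mods: "Suc 0 mod n = 1" "Suc (Suc 0) mod n = Suc (Suc 0)" using assms(1) by auto
  have "(if out r then (r, Suc r mod n) else (Suc r mod n, r)) \<in> set (zip vs (rotate1 vs))"
    if "r < n" for r
    unfolding arcs[symmetric] cycle_digraph_def using that by simp
  from this[of 0] this[of 1] assms mods show False
    using functional[of "Suc 0" 0 "Suc (Suc 0)"] injective[of 0 "Suc 0" "Suc (Suc 0)"] by (cases "out 0"; cases "out 1") auto
qed

lemma free_imp_no_short_cycle:
  assumes D: "pair_digraph D" and free: "free_of D (nondirected_cycles_upto (2 * l))"
    and n: "3 \<le> n" "n \<le> 2 * l" and inj: "inj_on w {..<n}"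
    and arcs: "\<And>r. r < n \<Longrightarrow> oarc (parcs D) (out r) (w r) (w (Suc r mod n))"
    and turn: "out 0 \<noteq> out (1 :: nat)"
  shows False
proof -
  interpret pair_digraph D by (rule D)
  let ?C = "cycle_digraph n out"
  have pverts: "pverts ?C = {..<n}" by (simp add: cycle_digraph_def)
  have "?C \<in> nondirected_cycles_upto (2 * l)"
    unfolding nondirected_cycles_upto_def oriented_cycles_upto_def
    using oriented_cycle_digraph[OF n(1)] not_directed_cycle_digraph[of n out] n turn
    by (simp add: pverts)
  moreover have "contains_digraph D ?C"
    unfolding contains_digraph_def
  proof (intro exI[of _ w] conjI)
    show "w ` pverts ?C \<subseteq> pverts D"
    proof -
      have "w r \<in> pverts D" if "r < n" for r
        using arcs[OF that] by (auto simp: oarc_def dest: wellformed' split: if_splits)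
      then show ?thesis by (auto simp: pverts)
    qed
    show "inj_on w (pverts ?C)" using inj by (simp add: pverts)
    show "\<forall>(x, y)\<in>parcs ?C. (w x, w y) \<in> parcs D"
      using arcs by (force simp: cycle_digraph_def oarc_def split: if_splits)
  qed
  ultimately show False using free unfolding free_of_def by blast
qed

lemma host_of_free_digraph:
  assumes "pair_digraph D" "free_of D (nondirected_cycles_upto (2 * l))"
  shows "host (parcs D) (min_pseudo_semidegree D) l"
proof -
  interpret pair_digraph D by fact
  show ?thesis
  proof
    show "finite (parcs D)" by (rule pair_finite_arcs)
    show "(v, v) \<notin> parcs D" for v using no_loops' by blast
  qed (use free_imp_no_short_cycle[OF assms] oarc_degree[OF assms(1)] in blast)+
qed

section \<open>Numbering an antidirected tree\<close>

text \<open>Extend a partial numbering by a neighbour of the first numbered vertex that still has an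
  unnumbered one. The parents of later vertices are then at least as large, because all vertices
  before the current parent have no unnumbered neighbours left. The vertex set is characterised by
  the connectivity assumption: no proper nonempty part is closed under \<open>E\<close>.\<close>

lemma bfs_numbering:
  fixes V :: "'a set" and E :: "'a rel"
  assumes "finite V" "V \<noteq> {}" and E: "E \<subseteq> V \<times> V"
    and conn: "\<And>X. X \<subseteq> V \<Longrightarrow> X \<noteq> {} \<Longrightarrow> (\<And>x y. x \<in> X \<Longrightarrow> (x, y) \<in> E \<Longrightarrow> y \<in> X) \<Longrightarrow> X = V"
  obtains n g par where "bij_betw g {..n} V" "par 0 = (0::nat)"
    "\<forall>i>0. par i < i" "\<forall>i. 0 < i \<and> i \<le> n \<longrightarrow> (g (par i), g i) \<in> E"
    "\<forall>i j. 0 < i \<and> i \<le> j \<and> j \<le> n \<longrightarrow> par i \<le> par j" "\<forall>i>n. par i = 0"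
proof -
  define Q where "Q n g par \<longleftrightarrow> inj_on g {..n} \<and> g ` {..n} \<subseteq> V \<and> par 0 = 0 \<and>
      (\<forall>i>0. par i < i) \<and> (\<forall>i. 0 < i \<and> i \<le> n \<longrightarrow> (g (par i), g i) \<in> E) \<and>
      (\<forall>i j. 0 < i \<and> i \<le> j \<and> j \<le> n \<longrightarrow> par i \<le> par j) \<and>
      (\<forall>i < par n. \<forall>y. (g i, y) \<in> E \<longrightarrow> y \<in> g ` {..n}) \<and> (\<forall>i>n. par i = 0)"
    for n :: nat and g :: "nat \<Rightarrow> 'a" and par :: "nat \<Rightarrow> nat"
  have grow: "\<exists>n g par. Q n g par \<and> (m \<le> n \<or> g ` {..n} = V)" for m
  proof (induction m)
    case 0
    obtain v where "v \<in> V" using \<open>V \<noteq> {}\<close> by blast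
    then have "Q 0 (\<lambda>_. v) (\<lambda>_. 0)" by (auto simp: Q_def)
    then show ?case by blast
  next
    case (Suc m)
    then obtain n g par where Q: "Q n g par" and or: "m \<le> n \<or> g ` {..n} = V" by blast
    show ?case
    proof (cases "g ` {..n} = V")
      case True
      with Q show ?thesis by blast
    next
      case False
      have q_inj: "inj_on g {..n}" and q_img: "g ` {..n} \<subseteq> V" and q_0: "par 0 = 0"
        and q_less: "\<And>j. 0 < j \<Longrightarrow> par j < j"
        and q_edge: "\<And>j. 0 < j \<Longrightarrow> j \<le> n \<Longrightarrow> (g (par j), g j) \<in> E"
        and q_mono: "\<And>j j'. 0 < j \<Longrightarrow> j \<le> j' \<Longrightarrow> j' \<le> n \<Longrightarrow> par j \<le> par j'"
        and q_done: "\<And>j z. j < par n \<Longrightarrow> (g j, z) \<in> E \<Longrightarrow> z \<in> g ` {..n}"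
        and q_beyond: "\<And>j. n < j \<Longrightarrow> par j = 0"
        using Q unfolding Q_def by blast+
      define open_at where "open_at i \<longleftrightarrow> i \<le> n \<and> (\<exists>y. (g i, y) \<in> E \<and> y \<notin> g ` {..n})" for i
      have "\<exists>i. open_at i"
      proof (rule ccontr)
        assume "\<nexists>i. open_at i"
        then have "g ` {..n} = V"
          using q_img by (intro conn) (auto simp: open_at_def)
        with False show False by simp
      qed
      define i where "i = (LEAST i. open_at i)"
      have "open_at i" unfolding i_def using \<open>\<exists>i. open_at i\<close> by (rule LeastI_ex)
      then obtain y where i: "i \<le> n" and y: "(g i, y) \<in> E" "y \<notin> g ` {..n}"
        by (auto simp: open_at_def)
      have below: "z \<in> g ` {..n}" if "i' < i" "(g i', z) \<in> E" for i' z
      proof -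
        have "\<not> open_at i'" using that(1) unfolding i_def by (rule not_less_Least)
        moreover have "i' \<le> n" using that(1) i by simp
        ultimately show ?thesis using that(2) unfolding open_at_def by blast
      qed
      have "par n \<le> i"
      proof (rule ccontr)
        assume "\<not> par n \<le> i"
        then have "i < par n" by simp
        then have "y \<in> g ` {..n}" using y(1) by (rule q_done)
        with y(2) show False by simp
      qed
      have "y \<in> V" using E y by auto
      let ?g = "g(Suc n := y)" and ?par = "par(Suc n := i)"
      have "Q (Suc n) ?g ?par"
        unfolding Q_def
      proof (intro conjI allI impI)
        have img: "?g ` {..n} = g ` {..n}" by auto
        show "inj_on ?g {..Suc n}"
          unfolding atMost_Suc
        proof (rule inj_on_insert[THEN iffD2], intro conjI)
          show "inj_on ?g {..n}" using q_inj by (auto simp: inj_on_def)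
          have "{..n} - {Suc n} = {..n}" by auto
          then show "?g (Suc n) \<notin> ?g ` ({..n} - {Suc n})" using y(2) img by simp
        qed
        show "?g ` {..Suc n} \<subseteq> V"
          using q_img \<open>y \<in> V\<close> img unfolding atMost_Suc image_insert by simp
        show "?par 0 = 0" using q_0 by simp
        show "?par j < j" if "0 < j" for j using q_less that i by simp
        show "(?g (?par j), ?g j) \<in> E" if "0 < j \<and> j \<le> Suc n" for j
        proof (cases "j = Suc n")
          case True
          then show ?thesis using y(1) i by simp
        next
          case False
          then have "j \<le> n" using that by simp
          moreover have "par j < Suc n" using q_less[of j] that \<open>j \<le> n\<close> by simp
          ultimately show ?thesis using q_edge[of j] that by simp
        qed
        show "?par j \<le> ?par j'" if j: "0 < j \<and> j \<le> j' \<and> j' \<le> Suc n" for j j'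
        proof -
          consider "j' \<le> n" | "j \<le> n" "j' = Suc n" | "j = Suc n" "j' = Suc n"
            using j by linarith
          then show ?thesis
          proof cases
            case 1
            then show ?thesis using q_mono[of j j'] j by simp
          next
            case 2
            then show ?thesis using q_mono[of j n] j \<open>par n \<le> i\<close> by simp
          qed simp
        qed
        show "z \<in> ?g ` {..Suc n}" if "j < ?par (Suc n)" "(?g j, z) \<in> E" for j z
          using below[of j z] that i img unfolding atMost_Suc image_insert by simp
        show "?par j = 0" if "Suc n < j" for j using that q_beyond by simp
      qed
      moreover have "Suc m \<le> Suc n" using or False by simp
      ultimately show ?thesis by blast
    qed
  qed
  obtain n g par where Q: "Q n g par" and or: "card V \<le> n \<or> g ` {..n} = V"
    using grow[of "card V"] by blast
  have "g ` {..n} = V"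
  proof (rule ccontr)
    assume "g ` {..n} \<noteq> V"
    then have "card V \<le> n" using or by simp
    moreover have "card (g ` {..n}) = Suc n" using Q by (simp add: Q_def card_image)
    moreover have "card (g ` {..n}) \<le> card V"
      using Q \<open>finite V\<close> by (intro card_mono) (auto simp: Q_def)
    ultimately show False by simp
  qed
  then have "bij_betw g {..n} V" using Q by (simp add: Q_def bij_betw_def)
  then show thesis using Q unfolding Q_def by (intro that[of g n par]) blast+
qed

context numbering
begin

text \<open>An edge that is not between a vertex and its parent closes the tree path between its ends to a
  closed walk \<open>z\<close> without backtracking: from \<open>j\<close> across the edge to \<open>i\<close>, up to the common ancestor,
  and down to \<open>j\<close>.\<close>

lemma extra_edge_gives_cycle:
  assumes U: "pair_wf_digraph U" and sym: "\<And>x y. (x, y) \<in> parcs U \<Longrightarrow> (y, x) \<in> parcs U"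
    and irrefl: "\<And>x. (x, x) \<notin> parcs U"
    and g: "inj_on g {..n}" and tree: "\<And>i. 0 < i \<Longrightarrow> i \<le> n \<Longrightarrow> (g (par i), g i) \<in> parcs U"
    and ij: "i < j" "j \<le> n" "par j \<noteq> i" and edge: "(g j, g i) \<in> parcs U"
  shows "\<exists>p. pre_digraph.cycle (with_proj U) p \<and> 3 \<le> length p"
proof -
  have geq: "g x = g y \<Longrightarrow> x = y" if "x \<le> n" "y \<le> n" for x y
    using inj_onD[OF g] that by simp
  have "near (i + j) i j"
    unfolding near_def using par_funpow_reaches_0[of i i] par_funpow_reaches_0[of j j]
    by (intro exI[of _ i] exI[of _ j]) simp
  moreover have "i \<noteq> j" using ij(1) by simp
  ultimately obtain a b where ab: "0 < a + b" "a + b \<le> i + j"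
    and meet: "(par ^^ a) i = (par ^^ b) j"
    and nz': "\<forall>r<a. (par ^^ r) i \<noteq> 0" "\<forall>r<b. (par ^^ r) j \<noteq> 0"
    and top': "0 < a \<and> 0 < b \<longrightarrow> (par ^^ (a - 1)) i \<noteq> (par ^^ (b - 1)) j"
    by (rule near_obtains_path)
  have nzi: "\<And>r. r < a \<Longrightarrow> (par ^^ r) i \<noteq> 0" and nzj: "\<And>r. r < b \<Longrightarrow> (par ^^ r) j \<noteq> 0"
    and top: "0 < a \<Longrightarrow> 0 < b \<Longrightarrow> (par ^^ (a - 1)) i \<noteq> (par ^^ (b - 1)) j"
    using nz' top' by blast+
  have in_n: "(par ^^ r) i \<le> n" "(par ^^ r) j \<le> n" for r
    using par_funpow_le[of r i] par_funpow_le[of r j] ij by linarith+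
  \<comment> \<open>The walk leaves \<open>j\<close> at time \<open>0\<close>, is at \<open>i\<close> at time \<open>1\<close> and at the common ancestor at
    time \<open>a + 1\<close>.\<close>
  define z where "z r = (if r = 0 then j else if r \<le> Suc a then (par ^^ (r - 1)) i
     else (par ^^ (a + b + 1 - r)) j)" for r
  have z_le: "z r \<le> n" for r using in_n ij by (auto simp: z_def)
  have z0: "z 0 = j" by (simp add: z_def)
  have zi: "z (Suc r) = (par ^^ r) i" if "r \<le> a" for r using that by (simp add: z_def)
  have zj: "z r = (par ^^ (a + b + 1 - r)) j" if "a < r" "r \<le> a + b + 1" for r
    using that meet by (cases "r = Suc a") (auto simp: z_def)
  let ?s = "a + b + 1"
  have step: "(g (z r), g (z (Suc r))) \<in> parcs U" if "r < ?s" for r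
  proof -
    consider "r = 0" | "0 < r" "r \<le> a" | "a < r" by linarith
    then show ?thesis
    proof cases
      case 1
      then show ?thesis using edge by (simp add: z_def)
    next
      case 2
      then obtain r' where r: "r = Suc r'" by (cases r) auto
      have "z r = (par ^^ r') i" "z (Suc r) = par ((par ^^ r') i)"
        using zi[of r'] zi[of r] 2 r by auto
      then show ?thesis using sym tree[of "(par ^^ r') i"] nzi[of r'] in_n(1)[of r'] 2 r by simp
    next
      case 3
      define q where "q = a + b + 1 - Suc r"
      have q: "a + b + 1 - r = Suc q" "q < b" using that 3 by (auto simp: q_def)
      have "z r = par ((par ^^ q) j)" "z (Suc r) = (par ^^ q) j"
        using zj[of r] zj[of "Suc r"] 3 that q by (auto simp: q_def)
      then show ?thesis using tree[of "(par ^^ q) j"] nzj[of q] in_n(2)[of q] q by simp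
    qed
  qed
  have nonback: "z r \<noteq> z (r + 2)" if "r + 2 \<le> ?s" for r
  proof -
    consider "r = 0" | "0 < r" "r < a" | "0 < r" "r = a" | "a < r" by linarith
    then show ?thesis
    proof cases
      case 1
      show ?thesis
      proof (cases "a = 0")
        case True
        then have "b \<noteq> 1" using meet ij(3) by auto
        then have b: "1 < b" using ab(1) True by simp
        have "(par ^^ (b - 1)) j < (par ^^ 0) j"
          using b nzj[of 0] by (intro par_funpow_strict) auto
        moreover have "z (r + 2) = (par ^^ (b - 1)) j" using zj[of "r + 2"] True b 1 by simp
        moreover have "z r = j" using 1 z0 by simp
        ultimately show ?thesis by simp
      next
        case False
        then have "z (r + 2) = par i" using zi[of 1] 1 by (simp add: numeral_2_eq_2)
        moreover have "z r = j" using 1 z0 by simp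
        moreover have "par i < j" using par_le[of i] ij(1) by simp
        ultimately show ?thesis by simp
      qed
    next
      case 2
      then obtain r' where r: "r = Suc r'" by (cases r) auto
      have "(par ^^ (r' + 2)) i < (par ^^ r') i"
        using nzi[of r'] 2 r by (intro par_funpow_strict) auto
      moreover have "z r = (par ^^ r') i" "z (r + 2) = (par ^^ (r' + 2)) i"
        using zi[of r'] zi[of "r' + 2"] 2 r by auto
      ultimately show ?thesis by simp
    next
      case 3
      then have "z r = (par ^^ (a - 1)) i" using zi[of "a - 1"] by simp
      moreover have "z (r + 2) = (par ^^ (b - 1)) j" using zj[of "r + 2"] 3 that by simp
      ultimately show ?thesis using top 3 that by simp
    next
      case 4
      define q where "q = a + b + 1 - (r + 2)"
      have q: "a + b + 1 - r = q + 2" "q < b" using that 4 by (auto simp: q_def)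
      have "(par ^^ (q + 2)) j < (par ^^ q) j" using nzj[of q] q by (intro par_funpow_strict) auto
      moreover have "z r = (par ^^ (q + 2)) j" "z (r + 2) = (par ^^ q) j"
        using zj[of r] zj[of "r + 2"] 4 that q by (auto simp: q_def)
      ultimately show ?thesis by simp
    qed
  qed
  let ?w = "\<lambda>r. g (z r)"
  have zs: "z ?s = j" using zj[of ?s] by simp
  have closed: "?w 0 = ?w ?s" unfolding zs z0 ..
  have w1: "?w r \<noteq> ?w (Suc r)" if "r < ?s" for r using step[OF that] irrefl by metis
  have w2: "?w r \<noteq> ?w (r + 2)" if "r + 2 \<le> ?s" for r
    using geq[OF z_le z_le, of r "r + 2"] nonback[OF that] by blast
  obtain c m where m: "3 \<le> m" "c + m \<le> ?s" "?w (c + m) = ?w c" "inj_on ?w {c..<c + m}"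
    by (rule closed_walk_contains_cycle[of ?s ?w]) (use closed w1 w2 in auto)
  have "inj_on (\<lambda>r. ?w (c + r)) {..<m}"
  proof (rule inj_onI)
    fix x y assume "x \<in> {..<m}" "y \<in> {..<m}" "?w (c + x) = ?w (c + y)"
    then show "x = y" using inj_onD[OF m(4), of "c + x" "c + y"] by simp
  qed
  moreover have "(?w (c + r), ?w (c + Suc r)) \<in> parcs U" if "r < m" for r
    using step[of "c + r"] that m(2) by simp
  ultimately have "pre_digraph.cycle (with_proj U) (map (\<lambda>r. (?w (c + r), ?w (c + Suc r))) [0..<m])"
    using cycle_of_closed_walk[OF U, of m "\<lambda>r. ?w (c + r)"] m by simp
  then show ?thesis using m(1) by (intro exI conjI) auto
qed

end

lemma undirected_tree_numbering:
  assumes "undirected_tree U"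
  obtains n g par where "bij_betw g {..n} (pverts U)" "par 0 = (0::nat)"
    "\<forall>i>0. par i < i" "\<forall>i. 0 < i \<and> i \<le> n \<longrightarrow> (g (par i), g i) \<in> parcs U"
    "\<forall>i j. 0 < i \<and> i \<le> j \<and> j \<le> n \<longrightarrow> par i \<le> par j" "\<forall>i>n. par i = 0"
proof -
  have U: "pair_graph U" "connected (with_proj U)" using assms by (auto simp: undirected_tree_def)
  interpret pair_graph U by (rule U(1))
  have "pverts U \<noteq> {}" using U(2) by (auto simp: connected_def strongly_connected_def)
  have "X = pverts U" if X: "X \<subseteq> pverts U" "X \<noteq> {}"
    "\<And>x y. x \<in> X \<Longrightarrow> (x, y) \<in> parcs U \<Longrightarrow> y \<in> X" for X
  proof -
    obtain x where "x \<in> X" using X(2) by blast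
    have "y \<in> X" if "y \<in> pverts U" for y
    proof -
      have "(x, y) \<in> rtrancl_on (pverts U) (parcs (mk_symmetric (with_proj U)))"
        using U(2) \<open>x \<in> X\<close> X(1) that
        by (auto simp: connected_def strongly_connected_def reachable_def)
      then show ?thesis
      proof (induction rule: rtrancl_on_induct)
        case base
        show ?case by (rule \<open>x \<in> X\<close>)
      next
        case (step y z)
        then have "(y, z) \<in> parcs U"
          using arcs_symmetric by (auto simp: parcs_mk_symmetric)
        then show ?case using X(3) step by blast
      qed
    qed
    then show ?thesis using X(1) by blast
  qed
  note closed = this
  have "parcs U \<subseteq> pverts U \<times> pverts U" by (auto dest: wellformed')
  show thesis
  proof (rule bfs_numbering[OF pair_finite_verts \<open>pverts U \<noteq> {}\<close> \<open>parcs U \<subseteq> _\<close>])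
    show "X = pverts U" if "X \<subseteq> pverts U" "X \<noteq> {}"
      "\<And>x y. x \<in> X \<Longrightarrow> (x, y) \<in> parcs U \<Longrightarrow> y \<in> X" for X
      by (rule closed[OF that])
  qed (rule that)
qed

text \<open>The second part says that the arcs of \<open>T\<close> are exactly the edges between a vertex and its parent,
  directed away from the source, and in particular that \<open>T\<close> has \<open>n\<close> arcs.\<close>

definition numbers_tree ::
  "nat \<Rightarrow> (nat \<Rightarrow> 'a) \<Rightarrow> (nat \<Rightarrow> nat) \<Rightarrow> (nat \<Rightarrow> bool) \<Rightarrow> 'a pair_pre_digraph \<Rightarrow> bool" where
  "numbers_tree n g par source T \<longleftrightarrow> bij_betw g {..n} (pverts T) \<and>
     bij_betw (\<lambda>i. if source (par i) then (g (par i), g i) else (g i, g (par i))) {1..n} (parcs T)"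

text \<open>Sources are the vertices with an outgoing arc. No arc ends in a source, so of two adjacent
  vertices exactly one is a source. Beyond \<open>n\<close> all parents are \<open>0\<close>, and \<open>source\<close> is chosen
  so as to alternate there as well.\<close>

lemma antidirected_tree_numbering:
  assumes "antidirected_tree T"
  obtains n g par source where "numbering par source" "numbers_tree n g par source T"
    "numbering.max_degree_le par n (max_degree T)"
    "\<forall>i j. 0 < i \<and> i \<le> j \<and> j \<le> n \<longrightarrow> par i \<le> par j"
proof -
  define U where "U = mk_symmetric (with_proj T)"
  have tree: "undirected_tree U" and "pair_graph U" and asym: "asym (parcs T)"
    and anti: "antidirected T"
    using assms by (auto simp: antidirected_tree_def oriented_tree_def orientation_of_def U_def)
  interpret pair_graph U by fact
  have pvU: "pverts U = pverts T" by (simp add: U_def)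
  have edge_iff: "(x, y) \<in> parcs U \<longleftrightarrow> (x, y) \<in> parcs T \<or> (y, x) \<in> parcs T" for x y
  proof -
    have PU: "parcs U = (\<Union>e\<in>parcs T. {(fst e, snd e), (snd e, fst e)})"
      by (simp add: U_def parcs_mk_symmetric)
    show ?thesis
    proof
      assume "(x, y) \<in> parcs U"
      then show "(x, y) \<in> parcs T \<or> (y, x) \<in> parcs T" unfolding PU by auto
    next
      assume "(x, y) \<in> parcs T \<or> (y, x) \<in> parcs T"
      then show "(x, y) \<in> parcs U"
        unfolding PU by (elim disjE) (rule UN_I, assumption, simp)+
    qed
  qed
  have asymD: "(y, x) \<notin> parcs T" if "(x, y) \<in> parcs T" for x y
    using asym that by (rule asymD)
  have no_path: False if "(x, y) \<in> parcs T" "(y, z) \<in> parcs T" for x y z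
  proof -
    have "x \<noteq> y" "y \<noteq> z" "x \<noteq> z" using asymD[OF that(1)] asymD[OF that(2)] that by auto
    then show False using anti that unfolding antidirected_def by auto
  qed
  obtain n g par where g: "bij_betw g {..n} (pverts U)" and par0: "par 0 = (0::nat)"
    and "\<forall>i>0. par i < i" "\<forall>i. 0 < i \<and> i \<le> n \<longrightarrow> (g (par i), g i) \<in> parcs U"
      "\<forall>i j. 0 < i \<and> i \<le> j \<and> j \<le> n \<longrightarrow> par i \<le> par j" "\<forall>i>n. par i = 0"
    by (rule undirected_tree_numbering[OF tree])
  then have par_less: "\<And>i. 0 < i \<Longrightarrow> par i < i"
    and edge: "\<And>i. 0 < i \<Longrightarrow> i \<le> n \<Longrightarrow> (g (par i), g i) \<in> parcs U"
    and mono: "\<forall>i j. 0 < i \<and> i \<le> j \<and> j \<le> n \<longrightarrow> par i \<le> par j"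
    and beyond: "\<And>i. n < i \<Longrightarrow> par i = 0"
    by blast+
  define source where "source i \<longleftrightarrow> (if i \<le> n then \<exists>y. (g i, y) \<in> parcs T
     else \<not> (\<exists>y. (g 0, y) \<in> parcs T))" for i
  have arc_true: "(g (par i), g i) \<in> parcs T \<and> \<not> source i"
    if "0 < i" "i \<le> n" "source (par i)" for i
  proof -
    have "par i \<le> n" using par_less[OF that(1)] that(2) by simp
    then have "\<exists>y. (g (par i), y) \<in> parcs T" using that(3) by (simp add: source_def)
    then obtain y where "(g (par i), y) \<in> parcs T" ..
    then have "(g (par i), g i) \<in> parcs T" using edge[OF that(1,2)] no_path edge_iff by blast
    moreover have "\<not> source i" using calculation no_path that(2) by (auto simp: source_def)
    ultimately show ?thesis by blast
  qed
  have arc_false: "(g i, g (par i)) \<in> parcs T \<and> source i"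
    if "0 < i" "i \<le> n" "\<not> source (par i)" for i
  proof -
    have "par i \<le> n" using par_less[OF that(1)] that(2) by simp
    then have "(g (par i), g i) \<notin> parcs T" using that(3) by (auto simp: source_def)
    then have "(g i, g (par i)) \<in> parcs T" using edge[OF that(1,2)] edge_iff by blast
    then show ?thesis using that(2) by (auto simp: source_def)
  qed
  interpret N: numbering par source
  proof
    show "par 0 = 0" by (rule par0)
    show "par i < i" if "0 < i" for i using that by (rule par_less)
    show "source i \<longleftrightarrow> \<not> source (par i)" if "0 < i" for i
    proof (cases "i \<le> n")
      case True
      then show ?thesis using arc_true[OF that] arc_false[OF that] by blast
    next
      case False
      then show ?thesis using beyond[of i] by (simp add: source_def)
    qed
  qed
  let ?arc = "\<lambda>i. if source (par i) then (g (par i), g i) else (g i, g (par i))"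
  have injg: "inj_on g {..n}" using g by (simp add: bij_betw_def)
  have geq: "g x = g y \<Longrightarrow> x = y" if "x \<le> n" "y \<le> n" for x y
    using inj_onD[OF injg] that by simp
  have par_n: "par i \<le> n" if "i \<le> n" for i using N.par_le[of i] that by simp
  have tree_edge: "par j = i" if "i < j" "j \<le> n" "(g j, g i) \<in> parcs U" for i j
  proof (rule ccontr)
    assume "par j \<noteq> i"
    have "\<exists>p. pre_digraph.cycle (with_proj U) p \<and> 3 \<le> length p"
    proof (rule N.extra_edge_gives_cycle[OF _ _ _ injg edge that(1,2) \<open>par j \<noteq> i\<close> that(3)])
      show "pair_wf_digraph U" by unfold_locales
      show "(y, x) \<in> parcs U" if "(x, y) \<in> parcs U" for x y using that by (rule arcs_symmetric)
      show "(x, x) \<notin> parcs U" for x using no_loops' by blast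
    qed
    then show False using tree unfolding undirected_tree_def by blast
  qed
  have "inj_on ?arc {1..n}"
  proof (rule inj_onI)
    fix i j assume ij: "i \<in> {1..n}" "j \<in> {1..n}" "?arc i = ?arc j"
    then have "g i = g j \<or> (g i = g (par j) \<and> g (par i) = g j)" by (auto split: if_splits)
    then show "i = j"
    proof
      assume "g i = g j" then show ?thesis using geq ij by auto
    next
      assume "g i = g (par j) \<and> g (par i) = g j"
      then have "i = par j" "par i = j" using geq[of i "par j"] geq[of "par i" j] par_n ij by auto
      then show ?thesis using par_less[of i] par_less[of j] ij by simp
    qed
  qed
  moreover have "?arc ` {1..n} = parcs T"
  proof
    show "?arc ` {1..n} \<subseteq> parcs T" using arc_true arc_false by auto
    show "parcs T \<subseteq> ?arc ` {1..n}"
    proof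
      fix e assume "e \<in> parcs T"
      obtain x y where e: "e = (x, y)" by (cases e)
      have xy: "(x, y) \<in> parcs T" using \<open>e \<in> parcs T\<close> e by simp
      then have U: "(x, y) \<in> parcs U" "(y, x) \<in> parcs U" using edge_iff by blast+
      then have "x \<in> g ` {..n}" "y \<in> g ` {..n}" using g wellformed' by (auto simp: bij_betw_def)
      then obtain i j where i: "x = g i" "i \<le> n" and j: "y = g j" "j \<le> n" by auto
      have "i \<noteq> j" using no_loops'[OF U(1)] i j by auto
      then consider "i < j" | "j < i" by linarith
      then show "e \<in> ?arc ` {1..n}"
      proof cases
        case 1
        then have "par j = i" using tree_edge[OF 1 j(2)] U i j by simp
        moreover have "source i" using xy i by (auto simp: source_def)
        ultimately have "?arc j = e" using e i j by simp
        then show ?thesis using 1 j by force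
      next
        case 2
        then have p: "par i = j" using tree_edge[OF 2 i(2)] U i j by simp
        have "source i" using xy i by (auto simp: source_def)
        then have "\<not> source j" using N.source_par[of i] p 2 by simp
        then have "?arc i = e" using e i j p by simp
        then show ?thesis using 2 i by force
      qed
    qed
  qed
  ultimately have "numbers_tree n g par source T"
    using g by (simp add: numbers_tree_def bij_betw_def pvU)
  moreover have "N.max_degree_le n (max_degree T)"
    unfolding N.max_degree_le_def
  proof (intro allI impI)
    fix i assume i: "i \<le> n"
    let ?K = "N.children n i \<union> (if i = 0 then {} else {par i})"
    have "par i \<notin> N.children n i" if "i \<noteq> 0"
      using par_less[of i] par_less[of "par i"] that by (auto simp: N.children_def)
    then have "card (N.children n i) + (if i = 0 then 0 else 1) = card ?K" by simp
    also have "\<dots> = card (g ` ?K)"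
    proof -
      have "?K \<subseteq> {..n}" using par_n[OF i] by (auto simp: N.children_def)
      then show ?thesis using injg by (metis card_image inj_on_subset)
    qed
    also have "\<dots> \<le> out_degree (with_proj U) (g i)"
    proof -
      have "Pair (g i) ` g ` ?K \<subseteq> out_arcs (with_proj U) (g i)"
      proof -
        have "(g i, g j) \<in> parcs U" if "j \<in> ?K" for j
        proof (cases "j \<in> N.children n i")
          case True
          then show ?thesis using edge[of j] by (auto simp: N.children_def)
        next
          case False
          then have "i \<noteq> 0" "j = par i" using that by (auto split: if_splits)
          then show ?thesis using arcs_symmetric[OF edge[of i]] i by simp
        qed
        then show ?thesis by auto
      qed
      moreover have "finite (out_arcs (with_proj U) (g i))" by auto
      ultimately have "card (Pair (g i) ` g ` ?K) \<le> out_degree (with_proj U) (g i)"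
        unfolding out_degree_def by (rule card_mono[rotated])
      then show ?thesis by (simp add: card_image inj_on_def)
    qed
    also have "\<dots> \<le> max_degree T"
    proof -
      have "g i \<in> pverts T" using g i pvU by (auto simp: bij_betw_def)
      then show ?thesis
        unfolding max_degree_def U_def[symmetric]
        using pair_finite_verts pvU by (intro Max_ge) auto
    qed
    finally show "card (N.children n i) + (if i = 0 then 0 else 1) \<le> max_degree T" .
  qed
  ultimately show thesis using mono by (rule that[OF N.numbering_axioms])
qed

lemma contains_of_copy:
  assumes D: "pair_digraph D" and "numbering_in_host (parcs D) d l par source"
    and T: "numbers_tree n g par source T"
    and f: "numbering_in_host.copy (parcs D) par source n f" and f0: "f 0 \<in> pverts D"
  shows "contains_digraph D T"
proof -
  interpret pair_digraph D by (rule D)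
  interpret numbering_in_host "parcs D" d l par source by fact
  have g: "bij_betw g {..n} (pverts T)" using T by (simp add: numbers_tree_def)
  define h where "h = f \<circ> the_inv_into {..n} g"
  have hg: "h (g i) = f i" if "i \<le> n" for i
    using g that by (simp add: h_def the_inv_into_f_f bij_betw_def)
  have inj: "inj_on f {..n}" using f by (simp add: copy_def)
  have arc: "oarc (parcs D) (source (par i)) (f (par i)) (f i)" if "0 < i" "i \<le> n" for i
    using f that by (simp add: copy_def nbs_def)
  have fD: "f i \<in> pverts D" if "i \<le> n" for i
    using arc[of i] that f0 by (cases "i = 0") (auto simp: oarc_def dest: wellformed' split: if_splits)
  have pverts: "pverts T = g ` {..n}" using g by (simp add: bij_betw_def)
  show ?thesis
    unfolding contains_digraph_def
  proof (intro exI[of _ h] conjI)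
    show "h ` pverts T \<subseteq> pverts D" using hg fD by (auto simp: pverts)
    show "inj_on h (pverts T)"
      using hg inj by (auto simp: pverts inj_on_def)
    show "\<forall>(x, y)\<in>parcs T. (h x, h y) \<in> parcs D"
    proof (clarify)
      fix x y assume "(x, y) \<in> parcs T"
      then obtain i where i: "i \<in> {1..n}"
        "(x, y) = (if source (par i) then (g (par i), g i) else (g i, g (par i)))"
        using T unfolding numbers_tree_def bij_betw_def by blast
      have "par i \<le> n" using par_le[of i] i by simp
      then show "(h x, h y) \<in> parcs D"
        using i arc[of i] hg by (auto simp: oarc_def split: if_splits)
    qed
  qed
qed

theorem theorem6:
  fixes k l :: nat
    and T :: "'a pair_pre_digraph"
    and D :: "'b pair_pre_digraph"
  assumes "l \<ge> 1"
    and "antidirected_tree T" and "card (parcs T) = k"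
    and "pair_digraph D" and "pverts D \<noteq> {}"
    and "real (min_pseudo_semidegree D) \<ge> max (real k / real l) (real (max_degree T))"
    and "free_of D (nondirected_cycles_upto (2 * l))"
  shows "contains_digraph D T"
proof -
  obtain n g par source where "numbering par source" and T: "numbers_tree n g par source T"
    and degree: "numbering.max_degree_le par n (max_degree T)"
    and mono: "\<forall>i j. 0 < i \<and> i \<le> j \<and> j \<le> n \<longrightarrow> par i \<le> par j"
    by (rule antidirected_tree_numbering[OF assms(2)])
  let ?d = "min_pseudo_semidegree D"
  interpret host "parcs D" ?d l by (rule host_of_free_digraph[OF assms(4,7)])
  interpret numbering par source by fact
  interpret E: numbering_in_host "parcs D" ?d l par source ..
  interpret D: pair_digraph D by (rule assms(4))
  have "n = k" using T assms(3) unfolding numbers_tree_def by (auto dest: bij_betw_same_card)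
  have "\<exists>f. E.copy n f \<and> f 0 \<in> pverts D"
  proof (cases "n = 0")
    case True
    obtain v where "v \<in> pverts D" using assms(5) by blast
    then have "E.copy n (\<lambda>_. v) \<and> v \<in> pverts D" using True by (auto simp: E.copy_def inj_on_def)
    then show ?thesis by blast
  next
    case False
    have le: "real k / real l \<le> real ?d" "max_degree T \<le> ?d" using assms(6) by auto
    have "k \<le> l * ?d"
    proof -
      have "real k \<le> real ?d * real l" using le(1) assms(1) by (simp add: divide_le_eq)
      then have "real k \<le> real (l * ?d)" by (simp add: mult.commute)
      then show ?thesis by (simp only: of_nat_le_iff)
    qed
    moreover have "0 < k" using False \<open>n = k\<close> by simp
    ultimately have "0 < ?d" by (metis gr0I mult_0_right not_le)
    then have "parcs D \<noteq> {}" by (auto simp: min_pseudo_semidegree_def)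
    then obtain x y where xy: "(x, y) \<in> parcs D" by auto
    obtain u v where uv: "v \<in> nbs (source 0) u"
      using xy that[of y x] that[of x y] by (cases "source 0") (auto simp: nbs_def oarc_def)
    have "max_degree_le n ?d"
      using degree le(2) unfolding max_degree_le_def by (meson le_trans)
    then obtain f where f: "E.copy n f"
      using E.copy_exists[OF uv assms(1)] mono \<open>k \<le> l * ?d\<close> \<open>n = k\<close> by blast
    have "par 1 = 0" using par_less[of 1] by simp
    then have "oarc (parcs D) (source 0) (f 0) (f 1)"
      using f False unfolding E.copy_def by (auto simp: nbs_def)
    then have "f 0 \<in> pverts D" by (auto simp: oarc_def dest: D.wellformed' split: if_splits)
    with f show ?thesis by blast
  qed
  then show ?thesis
    using contains_of_copy[OF assms(4) E.numbering_in_host_axioms T] by blast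
qed

end
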